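(* For every nested sequent $\Gamma$ and ordinal $\alpha$: if $\mathsf{D_C}\vdash^{\alpha}_{0}\Gamma$ then $\mathsf{G_C}\vdash^{\omega\cdot(\alpha+1)}_{0}F(\Gamma)$, where $F(\Gamma)$ is the corresponding formula of $\Gamma$ (regarded as a one-element shallow sequent).
   Context: Fix $h\ge1$ agents. Formulas: $A::=p\mid\bar p\mid A\vee A\mid A\wedge A\mid\Diamond_iA\mid\Box_iA\mid\widetilde{\mathsf C}A\mid\mathsf CA$ ($1\le i\le h$), $\widetilde{\mathsf C}$ the De Morgan dual of $\mathsf C$; $\bar A$ by De Morgan laws; $\bot:=p\wedge\bar p$. $\Box A:=\Box_1A\wedge\dots\wedge\Box_hA$, $\Diamond A:=\Diamond_1A\vee\dots\vee\Diamond_hA$ (left-associated), $\Box^k,\Diamond^k$ iterations. A nested sequent is a finite multiset of formulas and boxed sequents $[\Delta]_i$. Fixing arbitrary linear orders on formulas and on boxed sequents, the corresponding formula of $A_1,\dots,A_m,[\Delta_1]_{i_1},\dots,[\Delta_n]_{i_n}$ is $A_1\vee\dots\vee A_m\vee\Box_{i_1}F(\Delta_1)\vee\dots\vee\Box_{i_n}F(\Delta_n)$ (listed in these orders, left-associated), and $\bot$ for the empty sequent. Contexts $\Gamma\{\ \}$ as usual. System $\mathsf{D_C}$ (premises / conclusion): axiom $\Gamma\{p,\bar p\}$; $\wedge$: $\Gamma\{A\},\Gamma\{B\}/\Gamma\{A\wedge B\}$; $\vee$: $\Gamma\{A,B\}/\Gamma\{A\vee B\}$; $\Box_i$: $\Gamma\{[A]_i\}/\Gamma\{\Box_iA\}$;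 $\Diamond_i$: $\Gamma\{\Diamond_iA,[\Delta,A]_i\}/\Gamma\{\Diamond_iA,[\Delta]_i\}$; $\mathsf C$: premises $\Gamma\{\Box^kA\}$, all $k\ge1$ / $\Gamma\{\mathsf CA\}$; $\widetilde{\mathsf C}$: $\Gamma\{\widetilde{\mathsf C}A,\Diamond^kA\}/\Gamma\{\widetilde{\mathsf C}A\}$ (some $k\ge1$). A shallow sequent is a finite multiset of formulas; $\Diamond_i\Gamma$, $\widetilde{\mathsf C}\Gamma$ prefix each element. System $\mathsf{G_C}$: axiom $\Gamma,p,\bar p$; $\wedge$: $\Gamma,A$ and $\Gamma,B$ / $\Gamma,A\wedge B$; $\vee$: $\Gamma,A,B/\Gamma,A\vee B$; $\Box_i$: $\Gamma,\widetilde{\mathsf C}\Delta,A\,/\,\Diamond_i\Gamma,\widetilde{\mathsf C}\Delta,\Box_iA,\Sigma$; $\mathsf C$: premises $\Gamma,\Box^kA$ for all $k\ge1$ / $\Gamma,\mathsf CA$; $\widetilde{\mathsf C}$: $\Gamma,\widetilde{\mathsf C}A,\Diamond A/\Gamma,\widetilde{\mathsf C}A$. Proofs: well-founded, possibly infinitely branching trees with axiom leaves; depth = least ordinal greater than depths of immediate subproofs. $\mathcal S\vdash^\alpha_0\Gamma$: a cut-free proof of $\Gamma$ in $\mathcal S$ of depth $\le\alpha$. *)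

theory Defs
  imports "HOL-Library.Multiset" "HOL-Library.Countable_Set"
begin

section \<open>Formulas\<close>

text \<open>
  The agents \<open>1, \<dots>, h\<close> are the elements of a type \<open>'i\<close> of class \<open>{finite,linorder}\<close>,
  so \<open>h = CARD('i) \<ge> 1\<close>.  \<open>Com\<close> is the modality \<open>C\<close> and \<open>DCom\<close> its De Morgan dual.
\<close>

datatype ('i, 'p) fm =
    Pos 'p
  | Neg 'p
  | Or "('i, 'p) fm" "('i, 'p) fm"
  | And "('i, 'p) fm" "('i, 'p) fm"
  | Dia 'i "('i, 'p) fm"
  | Box 'i "('i, 'p) fm"
  | DCom "('i, 'p) fm"
  | Com "('i, 'p) fm"

definition bot_fm :: "'p \<Rightarrow> ('i, 'p) fm" where
  "bot_fm p = And (Pos p) (Neg p)"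

text \<open>Left-associated iteration of a binary operation over a nonempty list.\<close>

definition foldl1 :: "('a \<Rightarrow> 'a \<Rightarrow> 'a) \<Rightarrow> 'a list \<Rightarrow> 'a" where
  "foldl1 f xs = foldl f (hd xs) (tl xs)"

definition agents :: "'i::{finite,linorder} list" where
  "agents = sorted_list_of_set UNIV"

definition box_all :: "('i::{finite,linorder}, 'p) fm \<Rightarrow> ('i, 'p) fm" where
  "box_all A = foldl1 And (map (\<lambda>i. Box i A) agents)"

definition dia_all :: "('i::{finite,linorder}, 'p) fm \<Rightarrow> ('i, 'p) fm" where
  "dia_all A = foldl1 Or (map (\<lambda>i. Dia i A) agents)"


section \<open>Nested sequents and contexts\<close>

datatype ('i, 'p) item =
    is_Fm: Fm (the_fm: "('i, 'p) fm")
  | is_Bx: Bx (agent: 'i) (body: "('i, 'p) item multiset")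

type_synonym ('i, 'p) nseq = "('i, 'p) item multiset"

datatype ('i, 'p) ctxt =
    Hole "('i, 'p) nseq"
  | Inside "('i, 'p) nseq" 'i "('i, 'p) ctxt"

primrec fill :: "('i, 'p) ctxt \<Rightarrow> ('i, 'p) nseq \<Rightarrow> ('i, 'p) nseq" where
  "fill (Hole \<Gamma>) \<Delta> = \<Gamma> + \<Delta>"
| "fill (Inside \<Gamma> i c) \<Delta> = \<Gamma> + {#Bx i (fill c \<Delta>)#}"


section \<open>The corresponding formula\<close>

text \<open>A boxed sequent \<open>[\<Delta>]\<^sub>i\<close> is here the pair \<open>(i, \<Delta>)\<close>.\<close>

definition fms :: "('i, 'p) nseq \<Rightarrow> ('i, 'p) fm multiset" where
  "fms \<Gamma> = image_mset the_fm (filter_mset is_Fm \<Gamma>)"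

definition boxeds :: "('i, 'p) nseq \<Rightarrow> ('i \<times> ('i, 'p) nseq) multiset" where
  "boxeds \<Gamma> = image_mset (\<lambda>x. (agent x, body x)) (filter_mset is_Bx \<Gamma>)"

text \<open>
  The list of all \<open>f x\<close>, for \<open>x\<close> running through the multiset \<open>M\<close> in the linear order \<open>r\<close>.
  Fusing \<open>map\<close> with sorting lets the recursion of \<open>corr_fm\<close> below go through for an
  arbitrary relation \<open>r\<close>.
\<close>

definition map_sorted :: "'a rel \<Rightarrow> ('a \<Rightarrow> 'b) \<Rightarrow> 'a multiset \<Rightarrow> 'b list" where
  "map_sorted r f M =
    (THE ys. \<exists>xs. mset xs = M \<and> sorted_wrt (\<lambda>x y. (x, y) \<in> r) xs \<and> ys = map f xs)"

lemma map_sorted_cong [fundef_cong]: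
  assumes "r = s" "M = N" "\<And>x. x \<in># N \<Longrightarrow> f x = g x"
  shows "map_sorted r f M = map_sorted s g N"
proof -
  have "map f xs = map g xs" if "mset xs = N" for xs
    using assms(3) that by (auto simp flip: set_mset_mset)
  then have "(\<lambda>ys. \<exists>xs. mset xs = M \<and> sorted_wrt (\<lambda>x y. (x, y) \<in> r) xs \<and> ys = map f xs) =
    (\<lambda>ys. \<exists>xs. mset xs = N \<and> sorted_wrt (\<lambda>x y. (x, y) \<in> s) xs \<and> ys = map g xs)"
    using assms(1,2) by (intro ext) metis
  then show ?thesis unfolding map_sorted_def by simp
qed

lemma ex1_sorted_list:
  assumes "linear_order r"
  shows "\<exists>!xs. mset xs = M \<and> sorted_wrt (\<lambda>x y. (x, y) \<in> r) xs"
proof -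
  have r: "refl r" "trans r" "antisym r" "total r"
    using assms by (auto simp: linear_order_on_def partial_order_on_def preorder_on_def)
  interpret linorder "\<lambda>x y. (x, y) \<in> r" "\<lambda>x y. (x, y) \<in> r \<and> x \<noteq> y"
  proof
    fix x y z
    show "(x, y) \<in> r \<and> x \<noteq> y \<longleftrightarrow> (x, y) \<in> r \<and> (y, x) \<notin> r"
      using r(1,3) by (metis antisymD reflD)
    show "(x, x) \<in> r" using r(1) by (rule reflD)
    show "(x, y) \<in> r \<Longrightarrow> (y, z) \<in> r \<Longrightarrow> (x, z) \<in> r" using r(2) by (metis transD)
    show "(x, y) \<in> r \<Longrightarrow> (y, x) \<in> r \<Longrightarrow> x = y" using r(3) by (metis antisymD)
    show "(x, y) \<in> r \<or> (y, x) \<in> r" using r(1,4) by (metis reflD total_on_def UNIV_I)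
  qed
  obtain ys where ys: "mset ys = M" using ex_mset by blast
  show ?thesis
  proof (rule ex1I[of _ "sort ys"])
    show "mset (sort ys) = M \<and> sorted_wrt (\<lambda>x y. (x, y) \<in> r) (sort ys)"
      using ys sorted_sort by simp
  next
    fix xs assume "mset xs = M \<and> sorted_wrt (\<lambda>x y. (x, y) \<in> r) xs"
    then show "xs = sort ys" using ys properties_for_sort by metis
  qed
qed

lemma map_sorted_eqI:
  assumes "linear_order r" "mset xs = M" "sorted_wrt (\<lambda>x y. (x, y) \<in> r) xs"
  shows "map_sorted r f M = map f xs"
  unfolding map_sorted_def
proof (rule the_equality)
  show "\<exists>zs. mset zs = M \<and> sorted_wrt (\<lambda>x y. (x, y) \<in> r) zs \<and> map f xs = map f zs"
    using assms(2,3) by blast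
next
  fix ys
  assume "\<exists>zs. mset zs = M \<and> sorted_wrt (\<lambda>x y. (x, y) \<in> r) zs \<and> ys = map f zs"
  then show "ys = map f xs"
    using ex1_sorted_list[OF assms(1), of M] assms(2,3) by metis
qed

text \<open>
  Parameters of \<open>corr_fm\<close>: the atom \<open>p\<close> used in \<open>\<bottom>\<close>, the order on formulas, and the order
  on boxed sequents.
\<close>

function corr_fm ::
  "'p \<Rightarrow> ('i, 'p) fm rel \<Rightarrow> ('i \<times> ('i, 'p) nseq) rel \<Rightarrow> ('i, 'p) nseq \<Rightarrow> ('i, 'p) fm" where
  "corr_fm p rF rB \<Gamma> =
    (if \<Gamma> = {#} then bot_fm p
     else foldl1 Or
       (map_sorted rF (\<lambda>A. A) (fms \<Gamma>) @
        map_sorted rB (\<lambda>(i, \<Delta>). Box i (corr_fm p rF rB \<Delta>)) (boxeds \<Gamma>)))"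
  by pat_completeness auto

lemma size_boxeds:
  assumes "(i, \<Delta>) \<in># boxeds \<Gamma>"
  shows "size_multiset size \<Delta> < size_multiset size \<Gamma>"
proof -
  have "Bx i \<Delta> \<in># \<Gamma>" using assms by (auto simp: boxeds_def)
  then obtain \<Gamma>' where "\<Gamma> = add_mset (Bx i \<Delta>) \<Gamma>'" by (metis multi_member_split)
  then show ?thesis by simp
qed

termination
proof (relation "measure (\<lambda>(_, _, _, \<Gamma>). size_multiset size \<Gamma>)", goal_cases)
  case 1
  show ?case by (rule wf_measure)
next
  case 2
  then show ?case by simp (metis size_boxeds)
qed

declare corr_fm.simps [simp del]


section \<open>Ordinals\<close>

unbundle cardinal_syntax

text \<open>
  As in the library's theory of well-orders, ordinals are represented by well-orders
  (reflexive relations that are well-orders on their field) and compared with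
  \<open>\<le>o\<close>, \<open><o\<close> and \<open>=o\<close>.  The ordinal \<open>\<omega>\<close> is \<open>natLeq\<close>.
\<close>

definition ord_succ :: "'o rel \<Rightarrow> 'o option rel" where
  "ord_succ r = map_prod Some Some ` r \<union> (Some ` Field r \<union> {None}) \<times> {None}"

text \<open>The product \<open>r \<cdot> s\<close> consists of \<open>s\<close> many copies of \<open>r\<close>.\<close>

definition ord_mult :: "'a rel \<Rightarrow> 'b rel \<Rightarrow> ('a \<times> 'b) rel" where
  "ord_mult r s =
    {((x, y), (x', y')). x \<in> Field r \<and> x' \<in> Field r \<and> y \<in> Field s \<and> y' \<in> Field s \<and>
       ((y, y') \<in> s \<and> y \<noteq> y' \<or> y = y' \<and> (x, x') \<in> r)}"

lemma Field_ord_succ: "Field (ord_succ r) = insert None (Some ` Field r)"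
proof
  show "Field (ord_succ r) \<subseteq> insert None (Some ` Field r)"
    by (auto simp: ord_succ_def Field_def)
  have "(None, None) \<in> ord_succ r" by (simp add: ord_succ_def)
  moreover have "(Some x, None) \<in> ord_succ r" if "x \<in> Field r" for x
    using that by (simp add: ord_succ_def)
  ultimately show "insert None (Some ` Field r) \<subseteq> Field (ord_succ r)"
    by (auto intro: FieldI1)
qed

lemma Well_order_ord_succ:
  assumes "Well_order r"
  shows "Well_order (ord_succ r)"
proof -
  have lin: "refl_on (Field r) r" "trans r" "antisym r" "total_on (Field r) r" "wf (r - Id)"
    using assms by (auto simp: well_order_on_def linear_order_on_def partial_order_on_def
        preorder_on_def)
  have mem: "(a, b) \<in> ord_succ r \<longleftrightarrow>
    (case b of None \<Rightarrow> a \<in> insert None (Some ` Field r)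
     | Some y \<Rightarrow> (\<exists>x. a = Some x \<and> (x, y) \<in> r))" for a b
    by (cases b) (auto simp: ord_succ_def)
  have "refl_on (Field (ord_succ r)) (ord_succ r)"
    using lin(1) by (auto simp: Field_ord_succ refl_on_def mem split: option.splits)
  moreover have "ord_succ r \<subseteq> Field (ord_succ r) \<times> Field (ord_succ r)"
    by (auto simp: Field_def)
  moreover have "trans (ord_succ r)"
    using lin(2) unfolding trans_def mem
    by (auto split: option.splits intro: FieldI1)
  moreover have "antisym (ord_succ r)"
    using lin(3) unfolding antisym_def mem by (auto split: option.splits)
  moreover have "total_on (Field (ord_succ r)) (ord_succ r)"
    using lin(4) unfolding total_on_def mem Field_ord_succ by (auto split: option.splits)
  moreover have "wf (ord_succ r - Id)"
  proof (rule wfUNIVI)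
    fix P :: "'a option \<Rightarrow> bool" and a
    assume step: "\<forall>x. (\<forall>y. (y, x) \<in> ord_succ r - Id \<longrightarrow> P y) \<longrightarrow> P x"
    have some: "P (Some x)" for x
    proof (induction x rule: wf_induct_rule[OF lin(5)])
      case (1 x)
      then show ?case using step[rule_format, of "Some x"] by (auto simp: mem)
    qed
    then show "P a" using step[rule_format, of None] by (cases a) (auto simp: mem)
  qed
  ultimately show ?thesis
    by (auto simp: well_order_on_def linear_order_on_def partial_order_on_def preorder_on_def)
qed

lemma Field_ord_mult:
  assumes "Well_order r" "Well_order s"
  shows "Field (ord_mult r s) = Field r \<times> Field s"
proof
  show "Field (ord_mult r s) \<subseteq> Field r \<times> Field s"
    by (auto simp: ord_mult_def Field_def)
  have "refl_on (Field r) r"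
    using assms by (auto simp: well_order_on_def linear_order_on_def partial_order_on_def
        preorder_on_def)
  then have "((x, y), (x, y)) \<in> ord_mult r s" if "x \<in> Field r" "y \<in> Field s" for x y
    using that by (auto simp: ord_mult_def refl_on_def)
  then show "Field r \<times> Field s \<subseteq> Field (ord_mult r s)"
    by (auto intro: FieldI1)
qed

lemma Well_order_ord_mult:
  assumes "Well_order r" "Well_order s"
  shows "Well_order (ord_mult r s)"
proof -
  have r: "refl_on (Field r) r" "trans r" "antisym r" "total_on (Field r) r" "wf (r - Id)"
    and s: "refl_on (Field s) s" "trans s" "antisym s" "total_on (Field s) s" "wf (s - Id)"
    using assms by (auto simp: well_order_on_def linear_order_on_def partial_order_on_def
        preorder_on_def)
  note F = Field_ord_mult[OF assms]
  have "refl_on (Field (ord_mult r s)) (ord_mult r s)"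
    unfolding F using r(1) s(1) by (auto simp: refl_on_def ord_mult_def)
  moreover have "ord_mult r s \<subseteq> Field (ord_mult r s) \<times> Field (ord_mult r s)"
    unfolding F by (auto simp: ord_mult_def)
  moreover have "trans (ord_mult r s)"
  proof (rule transI)
    fix a b c assume "(a, b) \<in> ord_mult r s" "(b, c) \<in> ord_mult r s"
    moreover obtain x y x' y' x'' y'' where [simp]: "a = (x, y)" "b = (x', y')" "c = (x'', y'')"
      by (metis surj_pair)
    moreover have "(x, x') \<in> r \<Longrightarrow> (x', x'') \<in> r \<Longrightarrow> (x, x'') \<in> r"
      and "(y, y') \<in> s \<Longrightarrow> (y', y'') \<in> s \<Longrightarrow> (y, y'') \<in> s"
      and "(y, y') \<in> s \<Longrightarrow> (y', y) \<in> s \<Longrightarrow> y = y'"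
      using transD[OF r(2)] transD[OF s(2)] antisymD[OF s(3)] by blast+
    ultimately show "(a, c) \<in> ord_mult r s"
      unfolding ord_mult_def by simp blast
  qed
  moreover have "antisym (ord_mult r s)"
  proof (rule antisymI)
    fix a b assume "(a, b) \<in> ord_mult r s" "(b, a) \<in> ord_mult r s"
    then show "a = b"
      using antisymD[OF r(3), of "fst a" "fst b"] antisymD[OF s(3), of "snd a" "snd b"]
      by (cases a, cases b) (auto simp: ord_mult_def)
  qed
  moreover have "total_on (Field (ord_mult r s)) (ord_mult r s)"
    unfolding F using r(4) s(4) r(1) unfolding total_on_def ord_mult_def by auto
  moreover have "wf (ord_mult r s - Id)"
  proof (rule wf_subset)
    show "wf (inv_image ((s - Id) <*lex*> (r - Id)) prod.swap)"
      using r(5) s(5) by auto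
    show "ord_mult r s - Id \<subseteq> inv_image ((s - Id) <*lex*> (r - Id)) prod.swap"
      by (auto simp: ord_mult_def)
  qed
  ultimately show ?thesis
    by (auto simp: well_order_on_def linear_order_on_def partial_order_on_def preorder_on_def)
qed

text \<open>
  The least ordinal strictly greater than all members of \<open>X\<close>.  It is only used for countable
  sets \<open>X\<close> of countable ordinals; it is then again countable, and so represented by a
  well-order on natural numbers (lemma \<open>ord_lsub\<close>).
\<close>

definition ord_lsub :: "nat rel set \<Rightarrow> nat rel" where
  "ord_lsub X =
    (SOME r. Well_order r \<and> (\<forall>s \<in> X. s <o r) \<and>
       (\<forall>r' :: nat rel. Well_order r' \<and> (\<forall>s \<in> X. s <o r') \<longrightarrow> r \<le>o r'))"

lemma ord_upper_bound_exists:
  fixes X :: "nat rel set"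
  assumes X: "countable X" "\<forall>s \<in> X. Well_order s"
  shows "\<exists>r :: nat rel. Well_order r \<and> (\<forall>s \<in> X. s <o r)"
proof -
  define W where "W = cardSuc natLeq"
  have W_card: "Card_order W" and less_W: "natLeq <o W" and W_reg: "regularCard W"
    unfolding W_def
    using cardSuc_Card_order[OF natLeq_Card_order] cardSuc_greater[OF natLeq_Card_order]
      infinite_cardSuc_regularCard[OF _ natLeq_Card_order] by (auto simp: Field_natLeq)
  have W: "Well_order W" using W_card by (simp add: card_order_on_well_order_on)
  then have wo: "wo_rel W" by (simp add: wo_rel_def)
  have small: "\<not> W \<le>o card_of A" if "countable A" for A :: "'a set"
  proof
    assume "W \<le>o card_of A"
    also have "card_of A \<le>o card_of (UNIV :: nat set)"
      using that by (auto simp: countable_def card_of_ordLeq[symmetric])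
    also have "card_of (UNIV :: nat set) =o natLeq" by (rule card_of_nat)
    finally show False using less_W not_ordLess_ordLeq by blast
  qed
  have less: "s <o W" if "s \<in> X" for s
  proof (rule ccontr)
    assume "\<not> s <o W"
    then have "W \<le>o s" using X(2) that W not_ordLess_iff_ordLeq by blast
    then have "card_of (Field W) \<le>o card_of (Field s)" by (rule card_of_mono2)
    moreover have "W =o card_of (Field W)"
      using W_card card_of_Field_ordIso ordIso_symmetric by blast
    ultimately have "W \<le>o card_of (Field s)" using ordIso_ordLeq_trans by blast
    moreover have "countable (Field s)" by simp
    ultimately show False using small by blast
  qed
  then have "\<forall>s \<in> X. \<exists>a \<in> Field W. s =o Restr W (underS W a)"
    using X(2) W ordLess_iff_ordIso_Restr by blast
  then obtain g where g: "\<And>s. s \<in> X \<Longrightarrow> g s \<in> Field W"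
    "\<And>s. s \<in> X \<Longrightarrow> s =o Restr W (underS W (g s))" by metis
  have "\<not> cofinal (g ` X) W"
  proof
    assume "cofinal (g ` X) W"
    then have "W \<le>o card_of (g ` X)"
      using W_reg g(1) unfolding regularCard_def
      by (metis image_subsetI ordIso_iff_ordLeq)
    moreover have "countable (g ` X)" using X(1) by simp
    ultimately show False using small by blast
  qed
  then obtain a where a: "a \<in> Field W" "\<And>s. s \<in> X \<Longrightarrow> a = g s \<or> (a, g s) \<notin> W"
    unfolding cofinal_def by auto
  have le: "(g s, a) \<in> W" if "s \<in> X" for s
    using a(2)[OF that] a(1) g(1)[OF that] wo_rel.TOTALS[OF wo] by auto
  let ?R = "Restr W (under W a)"
  have R: "Well_order ?R" using W Well_order_Restr by blast
  have bound: "s <o ?R" if "s \<in> X" for s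
  proof -
    have "underS W (g s) \<subset> under W a"
    proof
      show "underS W (g s) \<subseteq> under W a"
        using le[OF that] wo_rel.TRANS[OF wo] by (auto simp: underS_def under_def dest: transD)
      show "underS W (g s) \<noteq> under W a"
        using le[OF that] by (auto simp: underS_def under_def)
    qed
    then have "Restr W (underS W (g s)) <o ?R"
      using ofilter_subset_ordLess[OF W] wo_rel.underS_ofilter[OF wo] wo_rel.under_ofilter[OF wo]
      by blast
    then show ?thesis using g(2)[OF that] ordIso_ordLess_trans by blast
  qed
  have "card_of (underS W a) <o W" using W_card a(1) by (rule card_of_underS)
  then have "card_of (underS W a) \<le>o natLeq"
    unfolding W_def using cardSuc_ordLeq_ordLess[OF natLeq_Card_order card_of_Card_order] by blast
  then have "card_of (underS W a) \<le>o card_of (UNIV :: nat set)"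
    using card_of_nat ordIso_symmetric ordLeq_ordIso_trans by blast
  then have "countable (underS W a)"
    by (auto simp: countable_def card_of_ordLeq[symmetric])
  moreover have "under W a \<subseteq> insert a (underS W a)" by (auto simp: underS_def under_def)
  ultimately have "countable (under W a)" by (meson countable_insert countable_subset)
  moreover have "Field ?R \<subseteq> under W a" by (auto simp: Field_def)
  ultimately have "countable (Field ?R)" by (rule countable_subset[rotated])
  then obtain f :: "nat set \<Rightarrow> nat" where f: "inj_on f (Field ?R)"
    unfolding countable_def by blast
  have "?R =o dir_image ?R f" using R f by (rule dir_image_ordIso)
  moreover have "Well_order (dir_image ?R f)" using R f by (rule Well_order_dir_image)
  ultimately show ?thesis using bound ordLess_ordIso_trans by blast
qed

lemma ord_lsub:
  fixes X :: "nat rel set"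
  assumes "countable X" "\<forall>s \<in> X. Well_order s"
  shows "Well_order (ord_lsub X)"
    and "\<And>s. s \<in> X \<Longrightarrow> s <o ord_lsub X"
    and "\<And>r' :: 'a rel. Well_order r' \<Longrightarrow> \<forall>s \<in> X. s <o r' \<Longrightarrow> ord_lsub X \<le>o r'"
proof -
  let ?S = "{r :: nat rel. Well_order r \<and> (\<forall>s \<in> X. s <o r)}"
  have "?S \<noteq> {}" using ord_upper_bound_exists[OF assms] by blast
  then have "\<exists>r \<in> ?S. \<forall>r' \<in> ?S. r \<le>o r'" by (rule exists_minim_Well_order) blast
  then have ex: "\<exists>r :: nat rel. Well_order r \<and> (\<forall>s \<in> X. s <o r) \<and>
       (\<forall>r' :: nat rel. Well_order r' \<and> (\<forall>s \<in> X. s <o r') \<longrightarrow> r \<le>o r')" by blast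
  note L = someI_ex[OF ex, folded ord_lsub_def]
  show wo: "Well_order (ord_lsub X)" and "\<And>s. s \<in> X \<Longrightarrow> s <o ord_lsub X"
    using L by blast+
  fix r' :: "'a rel" assume r': "Well_order r'" "\<forall>s \<in> X. s <o r'"
  show "ord_lsub X \<le>o r'"
  proof (rule ccontr)
    assume "\<not> ord_lsub X \<le>o r'"
    then have lt: "r' <o ord_lsub X" using wo r'(1) not_ordLeq_iff_ordLess by blast
    then obtain q :: "nat rel" where q: "r' =o q" "q <o ord_lsub X"
      using internalize_ordLess[of r' "ord_lsub X"] by blast
    have "Well_order q" using q(2) by (auto simp: ordLess_def)
    moreover have "\<forall>s \<in> X. s <o q" using r'(2) q(1) ordLess_ordIso_trans by blast
    ultimately have "ord_lsub X \<le>o q" using L by blast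
    then show False using q(2) not_ordLess_ordLeq by blast
  qed
qed


section \<open>Proofs\<close>

text \<open>
  The immediate subproofs of a node, and the premises of a rule instance, are families
  indexed by a finite or infinite set of natural numbers (the domain of a partial function).
  A proof system is the set of its rule instances, given as a binary relation between families
  of premises and conclusions; an axiom is a rule without premises.
\<close>

datatype 's tree = Node (concl: 's) (subtrees: "nat \<Rightarrow> 's tree option")

type_synonym 's system = "(nat \<Rightarrow> 's option) \<Rightarrow> 's \<Rightarrow> bool"

inductive is_proof :: "'s system \<Rightarrow> 's tree \<Rightarrow> bool" for S :: "'s system" where
  "S (\<lambda>k. map_option concl (ts k)) \<Gamma> \<Longrightarrow>
   (\<And>k t. ts k = Some t \<Longrightarrow> is_proof S t) \<Longrightarrow>
   is_proof S (Node \<Gamma> ts)"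

primrec depth :: "'s tree \<Rightarrow> nat rel" where
  "depth (Node \<Gamma> ts) = ord_lsub (ran (\<lambda>k. map_option depth (ts k)))"

lemma depth_Node: "depth (Node \<Gamma> ts) = ord_lsub (depth ` ran ts)"
proof -
  have "ran (\<lambda>k. map_option depth (ts k)) = depth ` ran ts"
    by (auto simp: ran_def image_def)
  then show ?thesis by simp
qed

lemma countable_ran: "countable (ran (f :: nat \<Rightarrow> 'a option))"
proof -
  have "ran f \<subseteq> range (\<lambda>k. the (f k))" by (auto simp: ran_def image_def) (metis option.sel)
  then show ?thesis by (rule countable_subset) simp
qed

lemma Well_order_depth: "Well_order (depth t)"
proof (induction t)
  case (Node \<Gamma> ts)
  then have "\<forall>s \<in> depth ` ran ts. Well_order s"
    by (auto simp: ran_def) (metis rangeI)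
  then show ?case
    unfolding depth_Node by (intro ord_lsub(1)) (auto intro: countable_ran)
qed

lemma depth_greater:
  assumes "s \<in> ran ts"
  shows "depth s <o depth (Node \<Gamma> ts)"
  unfolding depth_Node
proof (rule ord_lsub(2))
  show "countable (depth ` ran ts)" using countable_ran by (rule countable_image)
  show "\<forall>s \<in> depth ` ran ts. Well_order s" using Well_order_depth by blast
  show "depth s \<in> depth ` ran ts" using assms by (rule imageI)
qed

lemma depth_least:
  fixes r :: "'o rel"
  assumes "Well_order r" "\<And>s. s \<in> ran ts \<Longrightarrow> depth s <o r"
  shows "depth (Node \<Gamma> ts) \<le>o r"
  unfolding depth_Node
proof (rule ord_lsub(3))
  show "countable (depth ` ran ts)" using countable_ran by (rule countable_image)
  show "\<forall>s \<in> depth ` ran ts. Well_order s" using Well_order_depth by blast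
  show "Well_order r" by (rule assms(1))
  show "\<forall>s \<in> depth ` ran ts. s <o r" using assms(2) by blast
qed

text \<open>The two systems below have no cut rule, so all their proofs are cut-free.\<close>

definition derivable :: "'s system \<Rightarrow> 'o rel \<Rightarrow> 's \<Rightarrow> bool" where
  "derivable S \<alpha> \<Gamma> \<longleftrightarrow> (\<exists>t. is_proof S t \<and> concl t = \<Gamma> \<and> depth t \<le>o \<alpha>)"


section \<open>The systems\<close>

inductive DC :: "('i::{finite,linorder}, 'p) nseq system" where
  ax: "DC Map.empty (fill G {#Fm (Pos p), Fm (Neg p)#})"
| conj: "DC [0 \<mapsto> fill G {#Fm A#}, 1 \<mapsto> fill G {#Fm B#}] (fill G {#Fm (And A B)#})"
| disj: "DC [0 \<mapsto> fill G {#Fm A, Fm B#}] (fill G {#Fm (Or A B)#})"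
| box: "DC [0 \<mapsto> fill G {#Bx i {#Fm A#}#}] (fill G {#Fm (Box i A)#})"
| dia: "DC [0 \<mapsto> fill G {#Fm (Dia i A), Bx i (\<Delta> + {#Fm A#})#}]
           (fill G {#Fm (Dia i A), Bx i \<Delta>#})"
| com: "DC (\<lambda>k. Some (fill G {#Fm ((box_all ^^ (k + 1)) A)#})) (fill G {#Fm (Com A)#})"
| dcom: "k \<ge> 1 \<Longrightarrow>
    DC [0 \<mapsto> fill G {#Fm (DCom A), Fm ((dia_all ^^ k) A)#}] (fill G {#Fm (DCom A)#})"

inductive GC :: "('i::{finite,linorder}, 'p) fm multiset system" where
  ax: "GC Map.empty (\<Gamma> + {#Pos p, Neg p#})"
| conj: "GC [0 \<mapsto> \<Gamma> + {#A#}, 1 \<mapsto> \<Gamma> + {#B#}] (\<Gamma> + {#And A B#})"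
| disj: "GC [0 \<mapsto> \<Gamma> + {#A, B#}] (\<Gamma> + {#Or A B#})"
| box: "GC [0 \<mapsto> \<Gamma> + image_mset DCom \<Delta> + {#A#}]
           (image_mset (Dia i) \<Gamma> + image_mset DCom \<Delta> + {#Box i A#} + \<Sigma>)"
| com: "GC (\<lambda>k. Some (\<Gamma> + {#(box_all ^^ (k + 1)) A#})) (\<Gamma> + {#Com A#})"
| dcom: "GC [0 \<mapsto> \<Gamma> + {#DCom A, dia_all A#}] (\<Gamma> + {#DCom A#})"

end

theory Submission
  imports Defs
begin

text \<open>
  Derivability with ordinal bounds is described by ranks \<open>(n, a)\<close>, standing for \<open>\<omega> \<cdot> a + n\<close>,
  and by induction a nested proof of rank \<open>a\<close> yields a shallow proof of rank \<open>(n, a)\<close> for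
  some \<open>n\<close>.  The difficulty is that a nested rule acts deep inside boxes, has possibly
  infinitely many premises, and that the box rule of the shallow system is not invertible.
  Suppose all premises \<open>\<Gamma>, \<box>\<^sub>iF\<^sub>k\<close> of such a rule are derivable with the same rank.
  Decompose the side formulas \<open>\<Gamma>\<close> by the invertible rules; as \<open>C A\<close> only leaves boxes and one
  unfolding of every \<open>DCom A\<close> suffices, this takes finitely many steps, and their number is
  bounded in terms of \<open>\<Gamma>\<close> uniformly over the infinitely many branches.  At a leaf, either some
  premise can be derived without \<open>\<box>\<^sub>iF\<^sub>k\<close>, and then so can the conclusion, or every premise
  was obtained by the box rule for \<open>\<box>\<^sub>iF\<^sub>k\<close>, with, up to weakening, the same side formulas.
  In the latter case the argument continues one level deeper.
\<close>

section \<open>Proof depth measured by points of a well-order\<close>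

text \<open>A point \<open>x\<close> of a well-order stands for the ordinal of the points below it.
  Each premise only needs some smaller point, so ranks are upper bounds and no suprema have to be
  computed.\<close>

inductive ranked :: "'s system \<Rightarrow> 'r rel \<Rightarrow> 'r \<Rightarrow> 's \<Rightarrow> bool"
  for S :: "'s system" and lt :: "'r rel" where
  rankedI: "S P \<Gamma> \<Longrightarrow>
   (\<And>k \<Delta>. P k = Some \<Delta> \<Longrightarrow> \<exists>y. (y, x) \<in> lt \<and> ranked S lt y \<Delta>) \<Longrightarrow>
   ranked S lt x \<Gamma>"

lemma ranked_mono:
  assumes "trans lt" "ranked S lt y \<Gamma>" "(y, x) \<in> lt"
  shows "ranked S lt x \<Gamma>"
  using assms(2)
proof cases
  case (rankedI P)
  then show ?thesis
    using assms(1,3) by (intro ranked.rankedI[of S P]) (blast dest: transD)+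
qed

text \<open>A depth strictly below \<open>R\<close> is isomorphic to a proper initial segment of
  \<open>R\<close>, hence given by a point \<open>x\<close>. Carrying this isomorphism through the
  induction shows that subproofs get smaller points.\<close>

lemma derivable_imp_ranked:
  assumes R: "Well_order R" and "is_proof S t" "depth t <o R"
  shows "\<exists>x \<in> Field R. depth t =o Restr R (underS R x) \<and> ranked S (R - Id) x (concl t)"
  using assms(2,3)
proof induction
  case (1 ts \<Gamma>)
  have wo: "wo_rel R" using R by (simp add: wo_rel_def)
  obtain x where x: "x \<in> Field R" "depth (Node \<Gamma> ts) =o Restr R (underS R x)"
    using 1(4) R Well_order_depth ordLess_iff_ordIso_Restr by blast
  have "ranked S (R - Id) x \<Gamma>"
  proof (rule rankedI[of S])
    show "S (\<lambda>k. map_option concl (ts k)) \<Gamma>" by (fact 1(1))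
  next
    fix k \<Delta>
    assume "map_option concl (ts k) = Some \<Delta>"
    then obtain t where t: "ts k = Some t" "concl t = \<Delta>" by auto
    have less: "depth t <o depth (Node \<Gamma> ts)" using t(1) by (intro depth_greater ranI)
    then obtain y where y: "y \<in> Field R" "depth t =o Restr R (underS R y)" "ranked S (R - Id) y \<Delta>"
      using 1(3)[OF t(1)] 1(4) t(2) ordLess_transitive by blast
    have "(y, x) \<in> R - Id"
    proof (rule ccontr)
      assume "(y, x) \<notin> R - Id"
      then have "(x, y) \<in> R" using x(1) y(1) wo_rel.TOTALS[OF wo] by auto
      then have "underS R x \<subseteq> underS R y"
        using underS_incr[OF wo_rel.TRANS[OF wo] wo_rel.ANTISYM[OF wo]] by blast
      then have "Restr R (underS R x) \<le>o Restr R (underS R y)"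
        using ofilter_subset_ordLeq[OF R] wo_rel.underS_ofilter[OF wo] by blast
      then have "depth (Node \<Gamma> ts) \<le>o depth t"
        using x(2) y(2) ordIso_ordLeq_trans ordIso_symmetric ordLeq_ordIso_trans by blast
      then show False using less not_ordLess_ordLeq by blast
    qed
    then show "\<exists>y. (y, x) \<in> R - Id \<and> ranked S (R - Id) y \<Delta>" using y(3) by blast
  qed
  then show ?case using x by auto
qed

text \<open>The subproofs chosen for the premises have depths strictly below the segment of
  \<open>x\<close>, so by leastness the tree assembled from them stays within that segment.\<close>

lemma ranked_imp_derivable:
  assumes R: "Well_order R" and "ranked S (R - Id) x \<Gamma>"
  shows "derivable S (Restr R (underS R x)) \<Gamma>"
  using assms(2)
proof induction
  case (rankedI P \<Gamma> x)
  have wo: "wo_rel R" using R by (simp add: wo_rel_def)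
  have "\<exists>t. is_proof S t \<and> concl t = \<Delta> \<and> depth t <o Restr R (underS R x)"
    if P: "P k = Some \<Delta>" for k \<Delta>
  proof -
    obtain y t where y: "(y, x) \<in> R - Id"
      and t: "is_proof S t" "concl t = \<Delta>" "depth t \<le>o Restr R (underS R y)"
      using rankedI.IH[OF P] unfolding derivable_def by blast
    have "underS R y \<subset> underS R x"
      using y wo_rel.TRANS[OF wo] wo_rel.ANTISYM[OF wo]
      by (auto simp: underS_def dest: transD antisymD)
    then have "Restr R (underS R y) <o Restr R (underS R x)"
      using ofilter_subset_ordLess[OF R] wo_rel.underS_ofilter[OF wo] by blast
    then show ?thesis using t ordLeq_ordLess_trans by blast
  qed
  then have "\<forall>k. \<exists>t. \<forall>\<Delta>. P k = Some \<Delta> \<longrightarrow>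
      is_proof S t \<and> concl t = \<Delta> \<and> depth t <o Restr R (underS R x)"
    by (metis option.inject)
  then obtain T where T: "\<And>k \<Delta>. P k = Some \<Delta> \<Longrightarrow>
      is_proof S (T k) \<and> concl (T k) = \<Delta> \<and> depth (T k) <o Restr R (underS R x)"
    by metis
  define ts where "ts k = map_option (\<lambda>_. T k) (P k)" for k
  have P: "(\<lambda>k. map_option concl (ts k)) = P"
  proof
    fix k show "map_option concl (ts k) = P k"
      using T[of k] by (cases "P k") (simp_all add: ts_def)
  qed
  have "is_proof S (Node \<Gamma> ts)"
  proof (rule is_proof.intros)
    show "S (\<lambda>k. map_option concl (ts k)) \<Gamma>" unfolding P by (fact rankedI.hyps)
    show "is_proof S t" if "ts k = Some t" for k t using that T[of k] by (auto simp: ts_def)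
  qed
  moreover have "depth (Node \<Gamma> ts) \<le>o Restr R (underS R x)"
    using Well_order_Restr[OF R] T by (intro depth_least) (force simp: ts_def ran_def)+
  ultimately show ?case unfolding derivable_def by (metis tree.sel(1))
qed


section \<open>The shallow system\<close>

text \<open>
  Replacing every formula of a derivable sequent \<open>M\<close> by parts of it that arise by inverting
  rules gives a derivable sequent; \<open>N\<close> may also drop repetitions and contain further formulas.
\<close>

inductive covers :: "('i::{finite,linorder}, 'p) fm multiset \<Rightarrow> ('i, 'p) fm \<Rightarrow> bool"
  for N where
  mem: "A \<in># N \<Longrightarrow> covers N A"
| disj: "covers N A \<Longrightarrow> covers N B \<Longrightarrow> covers N (Or A B)"
| conj1: "covers N A \<Longrightarrow> covers N (And A B)"
| conj2: "covers N B \<Longrightarrow> covers N (And A B)"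
| com: "covers N ((box_all ^^ (k + 1)) A) \<Longrightarrow> covers N (Com A)"

lemma covers_trans:
  assumes "covers M A" "\<And>B. B \<in># M \<Longrightarrow> covers N B"
  shows "covers N A"
  using assms(1)
proof induction
  case (com k A)
  show ?case using com.IH by (rule covers.com)
qed (simp_all add: assms(2) covers.disj covers.conj1 covers.conj2)

lemma covers_atomD:
  "covers N (Pos p) \<Longrightarrow> Pos p \<in># N"
  "covers N (Neg p) \<Longrightarrow> Neg p \<in># N"
  "covers N (Dia i A) \<Longrightarrow> Dia i A \<in># N"
  "covers N (Box i A) \<Longrightarrow> Box i A \<in># N"
  "covers N (DCom A) \<Longrightarrow> DCom A \<in># N"
  by (auto elim: covers.cases)

text \<open>Weakening, contraction and inversion are proved together, at no cost in rank, by
  induction on the derivation. If the principal formula is decomposed in \<open>N\<close>, a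
  matching premise already yields \<open>N\<close>; otherwise the rule is applied again.\<close>

lemma ranked_covers:
  assumes tr: "trans lt" and "ranked GC lt x M" "\<And>A. A \<in># M \<Longrightarrow> covers N A"
  shows "ranked GC lt x N"
  using assms(2,3)
proof (induction arbitrary: N)
  case (rankedI P M x)
  have prem: "\<exists>y. (y, x) \<in> lt \<and> ranked GC lt y N'"
    if P: "P k = Some \<Delta>" and cov: "\<And>A. A \<in># \<Delta> \<Longrightarrow> covers N' A" for k \<Delta> N'
  proof -
    obtain y where "(y, x) \<in> lt" "\<And>N. (\<And>A. A \<in># \<Delta> \<Longrightarrow> covers N A) \<Longrightarrow> ranked GC lt y N"
      using rankedI.IH[OF P] by auto
    then show ?thesis using cov by blast
  qed
  have weaken: "ranked GC lt x N"
    if P: "P k = Some \<Delta>" and cov: "\<And>A. A \<in># \<Delta> \<Longrightarrow> covers N A" for k \<Delta>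
  proof -
    obtain y where "(y, x) \<in> lt" "ranked GC lt y N" using prem[OF P cov] by auto
    then show ?thesis by (rule ranked_mono[OF tr, rotated])
  qed
  note cov = rankedI.prems
  \<comment> \<open>Side formulas may have been covered by the very formula \<open>C\<close> that is
    removed from \<open>N\<close>, so the new premise has to cover \<open>C\<close> again.\<close>
  have replace: "\<exists>y. (y, x) \<in> lt \<and> ranked GC lt y (N - {#C#} + E)"
    if P: "P k = Some (\<Gamma> + E)" and M: "M = \<Gamma> + {#C#}" and C: "covers (N - {#C#} + E) C"
    for k \<Gamma> C E
  proof (rule prem[OF P])
    fix A assume "A \<in># \<Gamma> + E"
    then consider "A \<in># \<Gamma>" | "A \<in># E" by auto
    then show "covers (N - {#C#} + E) A"
    proof cases
      case 1
      then have "covers N A" using cov M by simp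
      then show ?thesis
      proof (rule covers_trans)
        fix B assume "B \<in># N"
        then show "covers (N - {#C#} + E) B"
          using C by (cases "B = C") (auto intro!: covers.mem simp: in_diff_count)
      qed
    qed (simp add: covers.mem)
  qed
  from rankedI.hyps(1) show ?case
  proof cases
    case (ax \<Gamma> p)
    then have "Pos p \<in># N" "Neg p \<in># N - {#Pos p#}"
      using cov covers_atomD(1,2)[of N p] by (auto simp: in_diff_count)
    then have "N = (N - {#Pos p#} - {#Neg p#}) + {#Pos p, Neg p#}"
      by (metis add_mset_add_single insert_DiffM2 union_mset_add_mset_right)
    then have "GC Map.empty N" by (metis GC.ax)
    then show ?thesis by (rule ranked.rankedI) simp
  next
    case (conj \<Gamma> A B)
    have "covers N (And A B)" using cov conj by simp
    then show ?thesis
    proof cases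
      case mem
      let ?N = "N - {#And A B#}"
      have "GC [0 \<mapsto> ?N + {#A#}, 1 \<mapsto> ?N + {#B#}] N"
        using GC.conj[of ?N A B] mem by simp
      moreover have "\<exists>y. (y, x) \<in> lt \<and> ranked GC lt y (?N + {#A#})"
        using conj by (intro replace[of 0 \<Gamma>]) (simp_all add: covers.disj covers.conj1 covers.mem)
      moreover have "\<exists>y. (y, x) \<in> lt \<and> ranked GC lt y (?N + {#B#})"
        using conj by (intro replace[of 1 \<Gamma>]) (simp_all add: covers.conj2 covers.mem)
      ultimately show ?thesis
        by (intro ranked.rankedI) (auto split: if_splits)
    next
      case conj1
      then show ?thesis using cov conj by (intro weaken[of 0 "\<Gamma> + {#A#}"]) auto
    next
      case conj2
      then show ?thesis using cov conj by (intro weaken[of 1 "\<Gamma> + {#B#}"]) auto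
    qed
  next
    case (disj \<Gamma> A B)
    have "covers N (Or A B)" using cov disj by simp
    then show ?thesis
    proof cases
      case mem
      let ?N = "N - {#Or A B#}"
      have "GC [0 \<mapsto> ?N + {#A, B#}] N" using GC.disj[of ?N A B] mem by simp
      moreover have "\<exists>y. (y, x) \<in> lt \<and> ranked GC lt y (?N + {#A, B#})"
        using disj by (intro replace[of 0 \<Gamma>]) (simp_all add: covers.disj covers.conj1 covers.mem)
      ultimately show ?thesis by (intro ranked.rankedI) (auto split: if_splits)
    next
      case disj
      then show ?thesis using cov \<open>P = _\<close> \<open>M = _\<close> by (intro weaken[of 0 "\<Gamma> + {#A, B#}"]) auto
    qed
  next
    case (box \<Gamma> \<Delta> A i \<Sigma>)
    \<comment> \<open>\<open>N\<close> may contain formulas repeated in \<open>M\<close> only once,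
      so the rule is applied again to the sets of side formulas.\<close>
    let ?\<Gamma> = "mset_set (set_mset \<Gamma>)" and ?\<Delta> = "mset_set (set_mset \<Delta>)"
    let ?M = "image_mset (Dia i) ?\<Gamma> + image_mset DCom ?\<Delta> + {#Box i A#}"
    have "covers N (Dia i B)" if "B \<in># \<Gamma>" for B using cov box(2) that by simp
    moreover have "covers N (DCom B)" if "B \<in># \<Delta>" for B using cov box(2) that by simp
    moreover have "covers N (Box i A)" using cov box(2) by simp
    ultimately have mem: "Dia i ` set_mset \<Gamma> \<union> DCom ` set_mset \<Delta> \<union> {Box i A} \<subseteq> set_mset N"
      using covers_atomD(3-5)[of N] by blast
    have "?M = mset_set (Dia i ` set_mset \<Gamma>) + mset_set (DCom ` set_mset \<Delta>) + mset_set {Box i A}"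
      by (simp add: image_mset_mset_set inj_on_def)
    also have "\<dots> = mset_set (Dia i ` set_mset \<Gamma> \<union> DCom ` set_mset \<Delta>) + mset_set {Box i A}"
      by (subst mset_set_Union) auto
    also have "\<dots> = mset_set (Dia i ` set_mset \<Gamma> \<union> DCom ` set_mset \<Delta> \<union> {Box i A})"
      by (subst mset_set_Union) auto
    also have "\<dots> \<subseteq># N"
      using mem by (metis finite_set_mset mset_set_set_mset_msubset subset_imp_msubset_mset_set
          subset_mset.trans)
    finally obtain \<Sigma>' where N: "N = ?M + \<Sigma>'" by (auto simp only: subset_mset.le_iff_add)
    have "GC [0 \<mapsto> ?\<Gamma> + image_mset DCom ?\<Delta> + {#A#}] N"
      unfolding N by (rule GC.box)
    moreover have "\<exists>y. (y, x) \<in> lt \<and> ranked GC lt y (?\<Gamma> + image_mset DCom ?\<Delta> + {#A#})"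
      using box
      by (intro prem[of 0 "\<Gamma> + image_mset DCom \<Delta> + {#A#}"]) (auto intro: covers.mem)
    ultimately show ?thesis by (intro ranked.rankedI) (auto split: if_splits)
  next
    case (com \<Gamma> A)
    have "covers N (Com A)" using cov com by simp
    then show ?thesis
    proof cases
      case mem
      let ?N = "N - {#Com A#}"
      have "GC (\<lambda>k. Some (?N + {#(box_all ^^ (k + 1)) A#})) N" using GC.com[of ?N A] mem by simp
      moreover have "\<exists>y. (y, x) \<in> lt \<and> ranked GC lt y (?N + {#(box_all ^^ (k + 1)) A#})" for k
        using com
        by (intro replace[of k \<Gamma>]) (simp_all add: covers.mem covers.com[of _ k] del: funpow.simps)
      ultimately show ?thesis by (intro ranked.rankedI) (auto simp del: funpow.simps)
    next
      case (com k)
      then show ?thesis using cov \<open>P = _\<close> \<open>M = _\<close>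
        by (intro weaken[of k "\<Gamma> + {#(box_all ^^ (k + 1)) A#}"]) auto
    qed
  next
    case (dcom \<Gamma> A)
    have mem: "DCom A \<in># N" using cov dcom(2) by (intro covers_atomD(5)) simp
    let ?N = "N - {#DCom A#}"
    have "GC [0 \<mapsto> ?N + {#DCom A, dia_all A#}] N" using GC.dcom[of ?N A] mem by simp
    moreover have "\<exists>y. (y, x) \<in> lt \<and> ranked GC lt y (?N + {#DCom A, dia_all A#})"
      using dcom by (intro replace[of 0 \<Gamma>]) (simp_all add: covers.disj covers.conj1 covers.mem)
    ultimately show ?thesis by (intro ranked.rankedI) (auto split: if_splits)
  qed
qed

lemma ranked_weaken:
  assumes "trans lt" "ranked GC lt x M" "set_mset M \<subseteq> set_mset N"
  shows "ranked GC lt x N"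
  using assms(1,2) by (rule ranked_covers) (use assms(3) in \<open>auto intro: covers.mem\<close>)

text \<open>The largest context, up to repetitions, that the box rule for \<open>i\<close> can pass
  to its premise; everything else goes into its weakening part \<open>\<Sigma>\<close>.\<close>

definition unbox :: "'i \<Rightarrow> ('i, 'p) fm multiset \<Rightarrow> ('i, 'p) fm multiset" where
  "unbox i M = (\<Sum>A\<in>#M. case A of Dia j B \<Rightarrow> if j = i then {#B#} else {#}
     | DCom B \<Rightarrow> {#DCom B#} | _ \<Rightarrow> {#})"


lemma set_unbox: "set_mset (unbox i M) = {B. Dia i B \<in># M} \<union> (set_mset M \<inter> range DCom)"
  by (induction M) (auto simp: unbox_def split: fm.splits)

section \<open>Ranks \<open>\<omega> \<cdot> a + n\<close> and cumulative rules of the shallow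
  system\<close>

locale rank =
  fixes lt :: "'r rel"
  assumes wf_lt: "wf lt" and trans_lt: "trans lt"
begin

definition lex :: "(nat \<times> 'r) rel" where
  "lex = {((m, b), (n, a)). (b, a) \<in> lt \<or> b = a \<and> m < n}"

text \<open>Ordinal addition of \<open>n\<close> on the right: it never leaves the current copy of
  \<open>\<omega>\<close>.\<close>

definition raise :: "nat \<Rightarrow> nat \<times> 'r \<Rightarrow> nat \<times> 'r" where
  "raise n x = (fst x + n, snd x)"

lemma wf_lex: "wf lex"
proof (rule wf_subset)
  show "wf (inv_image (lt <*lex*> less_than) prod.swap)" using wf_lt by auto
qed (auto simp: lex_def)

lemma trans_lex: "trans lex"
  using trans_lt by (auto simp: lex_def trans_def)

lemma raise_0 [simp]: "raise 0 x = x"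
  and raise_raise [simp]: "raise m (raise n x) = raise (n + m) x"
  and raise_Suc_greater: "(raise n x, raise (Suc n) x) \<in> lex"
  and raise_1_greater: "(x, raise 1 x) \<in> lex"
  and raise_mono: "(y, x) \<in> lex \<Longrightarrow> (raise n y, raise n x) \<in> lex"
  by (auto simp: raise_def lex_def)

abbreviation D :: "nat \<times> 'r \<Rightarrow> ('i::{finite,linorder}, 'p) fm multiset \<Rightarrow> bool" where
  "D \<equiv> ranked GC lex"

lemmas D_mono = ranked_mono[OF trans_lex, of GC]
lemmas D_covers = ranked_covers[OF trans_lex]
lemmas D_weaken = ranked_weaken[OF trans_lex]

lemma D_raise_mono: "D (raise m x) M \<Longrightarrow> m \<le> n \<Longrightarrow> D (raise n x) M"
  by (cases "m = n") (auto elim!: D_mono, simp add: raise_def lex_def)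

lemma D_axI:
  assumes "Pos p \<in># M" "Neg p \<in># M"
  shows "D x M"
proof (rule D_weaken)
  show "D x ({#} + {#Pos p, Neg p#})" by (rule rankedI[of GC, OF GC.ax]) simp
qed (use assms in auto)

text \<open>Keeping the principal formula in the premises is harmless: \<open>M\<close> with a
  further copy of it has the same underlying set, so \<open>D_weaken\<close> contracts the copy. The
  next rules are obtained in the same way.\<close>

lemma D_conjI:
  assumes "And A B \<in># M" "(y, x) \<in> lex" "D y (M + {#A#})" "(z, x) \<in> lex" "D z (M + {#B#})"
  shows "D x M"
proof (rule D_weaken)
  show "D x (M + {#And A B#})"
    by (rule rankedI[of GC, OF GC.conj])
      (use assms in \<open>auto simp del: split_paired_Ex split: if_splits\<close>)
qed (use assms in auto)

lemma D_disjI: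
  assumes "Or A B \<in># M" "(y, x) \<in> lex" "D y (M + {#A, B#})"
  shows "D x M"
proof (rule D_weaken)
  show "D x (M + {#Or A B#})"
    by (rule rankedI[of GC, OF GC.disj])
      (use assms in \<open>auto simp del: split_paired_Ex split: if_splits\<close>)
qed (use assms in auto)

lemma D_comI:
  assumes "Com A \<in># M" "\<And>k. \<exists>y. (y, x) \<in> lex \<and> D y (M + {#(box_all ^^ (k + 1)) A#})"
  shows "D x M"
proof (rule D_weaken)
  show "D x (M + {#Com A#})"
    by (rule rankedI[of GC, OF GC.com]) (use assms(2) in \<open>simp del: funpow.simps\<close>)
qed (use assms in auto)

lemma D_dcomI:
  assumes "DCom A \<in># M" "(y, x) \<in> lex" "D y (M + {#dia_all A#})"
  shows "D x M"
proof (rule D_weaken)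
  have "D y (M + {#DCom A, dia_all A#})" using assms(3) by (rule D_weaken) auto
  then show "D x (M + {#DCom A#})"
    by (intro rankedI[of GC, OF GC.dcom])
      (use assms(2) in \<open>auto simp del: split_paired_Ex split: if_splits\<close>)
qed (use assms in auto)

lemma D_boxI:
  assumes "Box i A \<in># M" "(y, x) \<in> lex" "D y (unbox i M + {#A#})"
  shows "D x M"
proof (rule D_weaken)
  let ?\<Gamma> = "mset_set {B. Dia i B \<in># M}" and ?\<Delta> = "mset_set {B. DCom B \<in># M}"
  have "{B. Dia i B \<in># M} = Dia i -` set_mset M" "{B. DCom B \<in># M} = DCom -` set_mset M" by auto
  then have fin: "finite {B. Dia i B \<in># M}" "finite {B. DCom B \<in># M}"
    by (simp_all add: finite_vimageI inj_on_def)
  have "D y (?\<Gamma> + image_mset DCom ?\<Delta> + {#A#})"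
    using assms(3) by (rule D_weaken) (use fin in \<open>auto simp: set_unbox\<close>)
  then show "D x (image_mset (Dia i) ?\<Gamma> + image_mset DCom ?\<Delta> + {#Box i A#} + {#})"
    by (intro rankedI[of GC, OF GC.box])
      (use assms(2) in \<open>auto simp del: split_paired_Ex split: if_splits\<close>)
  show "set_mset (image_mset (Dia i) ?\<Gamma> + image_mset DCom ?\<Delta> + {#Box i A#} + {#}) \<subseteq> set_mset M"
    using fin assms(1) by auto
qed

text \<open>
  The rules in a cumulative form: principal formulas are kept in the premises, and in the rule
  for \<open>Box i\<close> all formulas that can pass to the premise do so.
\<close>

lemma D_cases:
  assumes "D x M"
  obtains
    (ax) p where "Pos p \<in># M" "Neg p \<in># M"
  | (conj) A B y z where "And A B \<in># M" "(y, x) \<in> lex" "D y (M + {#A#})"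
      "(z, x) \<in> lex" "D z (M + {#B#})"
  | (disj) A B y where "Or A B \<in># M" "(y, x) \<in> lex" "D y (M + {#A, B#})"
  | (box) i A y where "Box i A \<in># M" "(y, x) \<in> lex" "D y (unbox i M + {#A#})"
  | (com) A where "Com A \<in># M" "\<And>k. \<exists>y. (y, x) \<in> lex \<and> D y (M + {#(box_all ^^ (k + 1)) A#})"
  | (dcom) A y where "DCom A \<in># M" "(y, x) \<in> lex" "D y (M + {#dia_all A#})"
  using assms
proof cases
  case (rankedI P)
  have prem: "\<exists>y. (y, x) \<in> lex \<and> D y N"
    if P: "P k = Some \<Delta>" and sub: "set_mset \<Delta> \<subseteq> set_mset N" for k \<Delta> N
  proof -
    obtain y where "(y, x) \<in> lex" "D y \<Delta>" using rankedI(2)[OF P] by auto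
    then show ?thesis using D_weaken[OF _ sub] by blast
  qed
  from rankedI(1) show ?thesis
  proof cases
    case (ax \<Gamma> p)
    then show ?thesis by (intro that(1)[of p]) auto
  next
    case (conj \<Gamma> A B)
    have "\<exists>y. (y, x) \<in> lex \<and> D y (M + {#A#})"
      using conj by (intro prem[of 0 "\<Gamma> + {#A#}"]) auto
    moreover have "\<exists>y. (y, x) \<in> lex \<and> D y (M + {#B#})"
      using conj by (intro prem[of 1 "\<Gamma> + {#B#}"]) auto
    ultimately show ?thesis using that(2)[of A B] conj by auto
  next
    case (disj \<Gamma> A B)
    have "\<exists>y. (y, x) \<in> lex \<and> D y (M + {#A, B#})"
      using disj by (intro prem[of 0 "\<Gamma> + {#A, B#}"]) auto
    then show ?thesis using that(3)[of A B] disj by auto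
  next
    case (box \<Gamma> \<Delta> A i \<Sigma>)
    have "\<exists>y. (y, x) \<in> lex \<and> D y (unbox i M + {#A#})"
      using box by (intro prem[of 0 "\<Gamma> + image_mset DCom \<Delta> + {#A#}"]) (auto simp: set_unbox)
    then show ?thesis using that(4)[of i A] box by auto
  next
    case (com \<Gamma> A)
    have "\<exists>y. (y, x) \<in> lex \<and> D y (M + {#(box_all ^^ (k + 1)) A#})" for k
      using com by (intro prem[of k "\<Gamma> + {#(box_all ^^ (k + 1)) A#}"]) (auto simp del: funpow.simps)
    then show ?thesis using that(5)[of A] com by auto
  next
    case (dcom \<Gamma> A)
    have "\<exists>y. (y, x) \<in> lex \<and> D y (M + {#dia_all A#})"
      using dcom by (intro prem[of 0 "\<Gamma> + {#DCom A, dia_all A#}"]) auto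
    then show ?thesis using that(6)[of A] dcom by auto
  qed
qed

end

section \<open>Folded disjunctions, and a weight bounding decomposition\<close>

lemma agents_nonempty: "agents \<noteq> ([] :: 'i::{finite,linorder} list)"
  by (simp add: agents_def)

lemma set_agents [simp]: "set agents = UNIV"
  by (simp add: agents_def)

lemma foldl1_snoc: "xs \<noteq> [] \<Longrightarrow> foldl1 f (xs @ [x]) = f (foldl1 f xs) x"
  by (simp add: foldl1_def)

lemma foldl1_singleton [simp]: "foldl1 f [x] = x"
  by (simp add: foldl1_def)

lemma covers_foldl1_Or:
  "xs \<noteq> [] \<Longrightarrow> (\<And>A. A \<in> set xs \<Longrightarrow> covers N A) \<Longrightarrow> covers N (foldl1 Or xs)"
  by (induction xs rule: rev_nonempty_induct) (auto simp: foldl1_snoc intro: covers.disj)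

text \<open>Bounds the decomposition of a formula before the next box rule. Boxes are not opened, so
  the weight of \<open>Com A\<close> is independent of \<open>A\<close>; \<open>DCom A\<close> pays
  for a single unfolding to \<open>dia_all A\<close>.\<close>

primrec wt :: "('i::{finite,linorder}, 'p) fm \<Rightarrow> nat" where
  "wt (Pos p) = 1"
| "wt (Neg p) = 1"
| "wt (Or A B) = Suc (wt A + wt B)"
| "wt (And A B) = Suc (wt A + wt B)"
| "wt (Dia i A) = Suc (wt A)"
| "wt (Box i A) = 1"
| "wt (DCom A) = length (agents :: 'i list) * (wt A + 2)"
| "wt (Com A) = length (agents :: 'i list) * 2"

text \<open>Joining \<open>n\<close> formulas takes \<open>n - 1\<close> connectives of weight one
  each; \<open>Suc\<close> on both sides makes up for the missing one.\<close>

lemma wt_foldl1: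
  assumes "xs \<noteq> []"
  shows "Suc (wt (foldl1 Or xs)) = (\<Sum>A\<leftarrow>xs. Suc (wt A))"
    and "Suc (wt (foldl1 And xs)) = (\<Sum>A\<leftarrow>xs. Suc (wt A))"
  using assms by (induction xs rule: rev_nonempty_induct) (auto simp: foldl1_snoc)

lemma wt_dia_all: "Suc (wt (dia_all A)) = wt (DCom A)"
  by (simp add: dia_all_def wt_foldl1 agents_nonempty comp_def sum_list_triv)

lemma wt_box_all:
  fixes A B :: "('i::{finite,linorder}, 'p) fm"
  shows "Suc (wt (box_all A)) = wt (Com B)"
  by (simp add: box_all_def wt_foldl1 agents_nonempty comp_def sum_list_triv mult_2_right)

lemma wt_pos: "0 < wt A"
  by (induction A) (auto simp: agents_nonempty)

abbreviation wts :: "('i::{finite,linorder}, 'p) fm multiset \<Rightarrow> nat" where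
  "wts M \<equiv> \<Sum>A\<in>#M. wt A"

lemma wts_unbox_add_mset: "wts (unbox i (add_mset A M)) \<le> wts (unbox i M) + wt A"
  by (auto simp: unbox_def split: fm.splits)

section \<open>Rules inside boxes\<close>

text \<open>
  \<open>settled N A\<close>: no rule other than those for boxes can decompose \<open>A\<close> to any effect in a
  sequent containing \<open>N\<close>.
\<close>

primrec settled :: "('i::{finite,linorder}, 'p) fm multiset \<Rightarrow> ('i, 'p) fm \<Rightarrow> bool" where
  "settled N (Pos p) = True"
| "settled N (Neg p) = True"
| "settled N (Or A B) = False"
| "settled N (And A B) = False"
| "settled N (Dia i A) = True"
| "settled N (Box i A) = True"
| "settled N (DCom A) = covers N (dia_all A)"
| "settled N (Com A) = False"

lemma settled_covers:
  assumes "settled M A" "\<And>B. B \<in># M \<Longrightarrow> covers N B"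
  shows "settled N A"
  using assms by (cases A) (auto intro: covers_trans)

context rank
begin

text \<open>In a settled sequent the last rule is an axiom, a redundant unfolding of some
  \<open>DCom A\<close>, or a box rule. The unfolding is contracted and the induction continues; a
  box rule acts on \<open>Box i F\<close> or else discards it.\<close>

lemma settled_box_cases:
  assumes settled: "\<And>A. A \<in># \<Lambda> \<Longrightarrow> settled \<Lambda> A" and "D x (\<Lambda> + {#Box i F#})"
  shows "D x \<Lambda> \<or> (\<exists>y. (y, x) \<in> lex \<and> D y (unbox i \<Lambda> + {#F#}))"
  using assms(2)
proof (induction x rule: wf_induct_rule[OF wf_lex])
  case (1 x)
  from 1(2) show ?case
  proof (cases rule: D_cases)
    case (ax p)
    then show ?thesis by (auto intro: D_axI)
  next
    case (conj A B y z)
    then show ?thesis using settled[of "And A B"] by simp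
  next
    case (disj A B y)
    then show ?thesis using settled[of "Or A B"] by simp
  next
    case (com A)
    then show ?thesis using settled[of "Com A"] by simp
  next
    case (dcom A y)
    have "covers \<Lambda> (dia_all A)" using settled[of "DCom A"] dcom(1) by simp
    then have "covers (\<Lambda> + {#Box i F#}) (dia_all A)"
      by (rule covers_trans) (simp add: covers.mem)
    then have "D y (\<Lambda> + {#Box i F#})"
      by (intro D_covers[OF dcom(3)]) (auto intro: covers.mem)
    then consider "D y \<Lambda>" | z where "(z, y) \<in> lex" "D z (unbox i \<Lambda> + {#F#})"
      using 1(1)[OF dcom(2)] by blast
    then show ?thesis
    proof cases
      case 1
      then show ?thesis using D_mono[OF _ dcom(2)] by blast
    next
      case 2
      then show ?thesis using dcom(2) trans_lex by (blast dest: transD)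
    qed
  next
    case (box j A y)
    have "D y (unbox j \<Lambda> + {#A#})"
      using box(3) by (rule D_weaken) (auto simp: set_unbox)
    then show ?thesis
      using box(1,2) D_boxI[of j A \<Lambda> y x] by (auto simp del: split_paired_Ex)
  qed
qed

text \<open>
  The increase \<open>n\<close> of the rank may depend on the weight of the side sequent only: the leaves of
  an infinitely branching decomposition have to agree on \<open>n\<close>.
\<close>

definition adm ::
  "('i::{finite,linorder}, 'p) fm set \<Rightarrow> ('i, 'p) fm multiset set \<Rightarrow> ('i, 'p) fm multiset \<Rightarrow> bool"
  where
  "adm \<Theta> \<P> M \<longleftrightarrow> (\<forall>w. \<exists>n. \<forall>\<Gamma> x. \<Theta> \<subseteq> set_mset \<Gamma> \<longrightarrow> wts \<Gamma> \<le> w \<longrightarrow>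
     (\<forall>N \<in> \<P>. D x (\<Gamma> + N)) \<longrightarrow> D (raise n x) (\<Gamma> + M))"

lemma admI:
  assumes "\<And>\<Gamma> x. \<Theta> \<subseteq> set_mset \<Gamma> \<Longrightarrow> (\<And>N. N \<in> \<P> \<Longrightarrow> D x (\<Gamma> + N)) \<Longrightarrow> D (raise n x) (\<Gamma> + M)"
  shows "adm \<Theta> \<P> M"
  unfolding adm_def using assms by blast

lemma admE:
  assumes "adm \<Theta> \<P> M"
  obtains n where "\<And>\<Gamma> x. \<Theta> \<subseteq> set_mset \<Gamma> \<Longrightarrow> wts \<Gamma> \<le> w \<Longrightarrow>
    (\<And>N. N \<in> \<P> \<Longrightarrow> D x (\<Gamma> + N)) \<Longrightarrow> D (raise n x) (\<Gamma> + M)"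
  using assms unfolding adm_def by meson

text \<open>Formulas \<open>N\<close> shared by all premises and the conclusion may join the side
  sequent. This raises the weight bound by \<open>wts N\<close>, and \<open>N\<close> itself then
  supplies \<open>\<Theta>\<close>.\<close>

lemma adm_absorb:
  assumes "adm \<Theta> \<P> M" "\<Theta> \<subseteq> set_mset N"
  shows "adm {} ((+) N ` \<P>) (N + M)"
  unfolding adm_def
proof
  fix w
  obtain n where n: "\<And>\<Gamma> x. \<Theta> \<subseteq> set_mset \<Gamma> \<Longrightarrow> wts \<Gamma> \<le> w + wts N \<Longrightarrow>
    (\<And>N. N \<in> \<P> \<Longrightarrow> D x (\<Gamma> + N)) \<Longrightarrow> D (raise n x) (\<Gamma> + M)"
    using assms(1) by (rule admE[where w = "w + wts N"]) blast
  show "\<exists>n. \<forall>\<Gamma> x. {} \<subseteq> set_mset \<Gamma> \<longrightarrow> wts \<Gamma> \<le> w \<longrightarrow>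
     (\<forall>N \<in> (+) N ` \<P>. D x (\<Gamma> + N)) \<longrightarrow> D (raise n x) (\<Gamma> + (N + M))"
  proof (intro exI allI impI)
    fix \<Gamma> x
    assume "wts \<Gamma> \<le> w" "\<forall>N \<in> (+) N ` \<P>. D x (\<Gamma> + N)"
    then show "D (raise n x) (\<Gamma> + (N + M))"
      using n[of "\<Gamma> + N" x] assms(2) by (auto simp: add.assoc)
  qed
qed

text \<open>
  Decomposing the side formulas \<open>\<Gamma>\<close> by the invertible rules takes a number of steps bounded by
  their weight; each leaf is settled, and there \<open>settled_box_cases\<close> makes the proofs of all
  premises agree on the next box rule.
\<close>

lemma adm_box_settling:
  fixes \<F> :: "('i::{finite,linorder}, 'p) fm set"
  assumes adm: "adm \<Theta> ((\<lambda>G. {#G#}) ` \<F>) {#F#}"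
  shows "\<exists>n. \<forall>\<Gamma> \<Lambda> x. Dia i ` \<Theta> \<subseteq> set_mset (\<Gamma> + \<Lambda>) \<longrightarrow> wts \<Gamma> \<le> v \<longrightarrow>
    wts (unbox i \<Lambda>) \<le> w \<longrightarrow> (\<forall>A \<in># \<Lambda>. settled (\<Gamma> + \<Lambda>) A) \<longrightarrow>
    (\<forall>G \<in> \<F>. D x (\<Gamma> + \<Lambda> + {#Box i G#})) \<longrightarrow> D (raise n x) (\<Gamma> + \<Lambda> + {#Box i F#})"
\<comment> \<open>\<open>\<Gamma>\<close> is still to be decomposed and \<open>\<Lambda>\<close> is
  settled. The bound \<open>w\<close> concerns what \<open>\<Lambda>\<close> passes through the next
  box rule, and grows as formulas move from \<open>\<Gamma>\<close> to
  \<open>\<Lambda>\<close>.\<close>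
proof (induction v arbitrary: w)
  case 0
  obtain n where n: "\<And>\<Gamma> x. \<Theta> \<subseteq> set_mset \<Gamma> \<Longrightarrow> wts \<Gamma> \<le> w \<Longrightarrow>
    (\<And>N. N \<in> (\<lambda>G. {#G#}) ` \<F> \<Longrightarrow> D x (\<Gamma> + N)) \<Longrightarrow> D (raise n x) (\<Gamma> + {#F#})"
    using adm by (rule admE) blast
  show ?case
  proof (intro exI allI impI)
    fix \<Gamma> \<Lambda> :: "('i, 'p) fm multiset" and x
    assume \<Theta>: "Dia i ` \<Theta> \<subseteq> set_mset (\<Gamma> + \<Lambda>)" and "wts \<Gamma> \<le> 0"
      and w: "wts (unbox i \<Lambda>) \<le> w" and settled: "\<forall>A \<in># \<Lambda>. settled (\<Gamma> + \<Lambda>) A"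
      and prems: "\<forall>G \<in> \<F>. D x (\<Gamma> + \<Lambda> + {#Box i G#})"
    have [simp]: "\<Gamma> = {#}"
    proof (cases \<Gamma>)
      case (add A \<Gamma>')
      then show ?thesis using \<open>wts \<Gamma> \<le> 0\<close> wt_pos[of A] by simp
    qed
    show "D (raise (Suc n) x) (\<Gamma> + \<Lambda> + {#Box i F#})"
    \<comment> \<open>This alternative does not mention \<open>G\<close>, so it is decided for all
      premises at once: if it fails, each of them came from the box rule for its own
      \<open>Box i G\<close>.\<close>
    proof (cases "D x \<Lambda>")
      case True
      then have "D x (\<Gamma> + \<Lambda> + {#Box i F#})" by (rule D_weaken) auto
      then show ?thesis using D_raise_mono[of 0 x _ "Suc n"] by simp
    next
      case False
      have "D x (unbox i \<Lambda> + {#G#})" if "G \<in> \<F>" for G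
      proof -
        have "D x (\<Lambda> + {#Box i G#})" using prems that by simp
        then obtain y where "(y, x) \<in> lex" "D y (unbox i \<Lambda> + {#G#})"
          using settled_box_cases[of \<Lambda> x i G] settled False by auto
        then show ?thesis using D_mono by blast
      qed
      then have "D (raise n x) (unbox i \<Lambda> + {#F#})"
        using w \<Theta> by (intro n) (auto simp: set_unbox)
      then have "D (raise n x) (unbox i (\<Gamma> + \<Lambda> + {#Box i F#}) + {#F#})"
        by (rule D_weaken) (auto simp: set_unbox)
      then show ?thesis by (rule D_boxI[OF _ raise_Suc_greater, rotated]) simp
    qed
  qed
next
  case (Suc v)
  obtain n where n: "\<And>\<Gamma> \<Lambda> x. Dia i ` \<Theta> \<subseteq> set_mset (\<Gamma> + \<Lambda>) \<Longrightarrow> wts \<Gamma> \<le> v \<Longrightarrow>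
    wts (unbox i \<Lambda>) \<le> w + Suc v \<Longrightarrow> (\<And>A. A \<in># \<Lambda> \<Longrightarrow> settled (\<Gamma> + \<Lambda>) A) \<Longrightarrow>
    (\<And>G. G \<in> \<F> \<Longrightarrow> D x (\<Gamma> + \<Lambda> + {#Box i G#})) \<Longrightarrow> D (raise n x) (\<Gamma> + \<Lambda> + {#Box i F#})"
    using Suc[of "w + Suc v"] by meson
  show ?case
  proof (intro exI allI impI)
    fix \<Gamma> \<Lambda> :: "('i, 'p) fm multiset" and x
    assume \<Theta>: "Dia i ` \<Theta> \<subseteq> set_mset (\<Gamma> + \<Lambda>)" and v: "wts \<Gamma> \<le> Suc v"
      and w: "wts (unbox i \<Lambda>) \<le> w" and settled: "\<forall>A \<in># \<Lambda>. settled (\<Gamma> + \<Lambda>) A"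
      and prems: "\<forall>G \<in> \<F>. D x (\<Gamma> + \<Lambda> + {#Box i G#})"
    show "D (raise (Suc n) x) (\<Gamma> + \<Lambda> + {#Box i F#})"
    proof (cases \<Gamma>)
      case empty
      then have "D (raise n x) (\<Gamma> + \<Lambda> + {#Box i F#})"
        using \<Theta> v w settled prems by (intro n) auto
      then show ?thesis by (rule D_raise_mono) simp
    next
      case (add A \<Gamma>')
      have wA: "0 < wt A" "wt A \<le> Suc v" "wts \<Gamma>' \<le> v" "wt A + wts \<Gamma>' \<le> Suc v"
        using v wt_pos[of A] by (auto simp: add)
      have replace: "D (raise n x) (\<Gamma>' + E + \<Lambda> + {#Box i F#})"
        if "\<And>B. A \<noteq> Dia i B" "covers E A" "wts E < wt A" for E
      proof (rule n)
        have cov: "covers (\<Gamma>' + E + \<Lambda> + N) B" if "B \<in># \<Gamma> + \<Lambda> + N" for B N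
        proof (cases "B = A")
          case True
          show ?thesis unfolding True
            by (rule covers_trans[OF \<open>covers E A\<close>]) (simp add: covers.mem)
        next
          case False
          then show ?thesis using that by (auto simp: add intro: covers.mem)
        qed
        show "Dia i ` \<Theta> \<subseteq> set_mset (\<Gamma>' + E + \<Lambda>)" using \<Theta> that(1) by (auto simp: add)
        show "wts (\<Gamma>' + E) \<le> v" using wA that(3) by simp
        show "wts (unbox i \<Lambda>) \<le> w + Suc v" using w by simp
        show "settled (\<Gamma>' + E + \<Lambda>) B" if "B \<in># \<Lambda>" for B
          using settled that cov[of _ "{#}"] by (auto intro: settled_covers)
        show "D x (\<Gamma>' + E + \<Lambda> + {#Box i G#})" if "G \<in> \<F>" for G
          using prems[rule_format, OF that] cov by (rule D_covers)
      qed
      have principal: "D (raise n x) (\<Gamma> + \<Lambda> + {#Box i F#} + E)"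
        if "\<And>B. A \<noteq> Dia i B" "covers E A" "wts E < wt A" for E
        using replace[OF that] by (rule D_weaken) (auto simp: add)
      \<comment> \<open>Literals, diamonds and boxes are settled in every sequent and simply move to
        \<open>\<Lambda>\<close>.\<close>
      have settle: "D (raise (Suc n) x) (\<Gamma> + \<Lambda> + {#Box i F#})" if "\<And>N. settled N A"
      proof -
        have "D (raise n x) (\<Gamma>' + add_mset A \<Lambda> + {#Box i F#})"
        proof (rule n)
          show "wts (unbox i (add_mset A \<Lambda>)) \<le> w + Suc v"
            using w wA wts_unbox_add_mset[of i A \<Lambda>] by linarith
          show "settled (\<Gamma>' + add_mset A \<Lambda>) B" if "B \<in># add_mset A \<Lambda>" for B
            using settled that \<open>\<And>N. settled N A\<close> by (auto simp: add)
        qed (use \<Theta> wA prems in \<open>auto simp: add\<close>)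
        then show ?thesis using D_raise_mono[of n x _ "Suc n"] by (simp add: add)
      qed
      have step: "(raise n x, raise (Suc n) x) \<in> lex" by (rule raise_Suc_greater)
      show ?thesis
      proof (cases A)
        case (Or B C)
        have "D (raise n x) (\<Gamma> + \<Lambda> + {#Box i F#} + {#B, C#})"
          by (rule principal) (simp_all add: Or covers.disj covers.mem)
        then show ?thesis by (rule D_disjI[OF _ step, rotated]) (simp add: add Or)
      next
        case (And B C)
        have "D (raise n x) (\<Gamma> + \<Lambda> + {#Box i F#} + {#B#})"
          by (rule principal) (simp_all add: And covers.conj1 covers.mem)
        moreover have "D (raise n x) (\<Gamma> + \<Lambda> + {#Box i F#} + {#C#})"
          by (rule principal) (simp_all add: And covers.conj2 covers.mem)
        ultimately show ?thesis by (rule D_conjI[OF _ step _ step, rotated]) (simp add: add And)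
      next
        case (Com B)
        \<comment> \<open>The same \<open>n\<close> serves every \<open>k\<close>: all unfoldings of
          \<open>Com B\<close> have the same weight, one less than that of
          \<open>Com B\<close>.\<close>
        have "D (raise n x) (\<Gamma> + \<Lambda> + {#Box i F#} + {#(box_all ^^ (k + 1)) B#})" for k
        proof (rule principal)
          show "covers {#(box_all ^^ (k + 1)) B#} A"
            unfolding Com by (rule covers.com[of _ k]) (rule covers.mem, simp)
          show "wts {#(box_all ^^ (k + 1)) B#} < wt A"
            using wt_box_all[of "(box_all ^^ k) B" B] by (simp add: Com)
        qed (simp add: Com)
        then have "\<exists>y. (y, raise (Suc n) x) \<in> lex \<and>
            D y (\<Gamma> + \<Lambda> + {#Box i F#} + {#(box_all ^^ (k + 1)) B#})" for k
          using step by blast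
        then show ?thesis by (rule D_comI[rotated]) (simp add: add Com)
      next
        case (DCom B)
        \<comment> \<open>\<open>DCom B\<close> moves to \<open>\<Lambda>\<close>, where it is
          settled because its unfolding is now present; only that lighter unfolding remains to be
          decomposed.\<close>
        have "D (raise n x) (\<Gamma>' + {#dia_all B#} + add_mset A \<Lambda> + {#Box i F#})"
        proof (rule n)
          show "Dia i ` \<Theta> \<subseteq> set_mset (\<Gamma>' + {#dia_all B#} + add_mset A \<Lambda>)"
            using \<Theta> by (auto simp: add)
          show "wts (\<Gamma>' + {#dia_all B#}) \<le> v" using wA wt_dia_all[of B] by (simp add: DCom)
          show "wts (unbox i (add_mset A \<Lambda>)) \<le> w + Suc v"
            using w wA wts_unbox_add_mset[of i A \<Lambda>] by linarith
          show "settled (\<Gamma>' + {#dia_all B#} + add_mset A \<Lambda>) C" if "C \<in># add_mset A \<Lambda>" for C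
          proof (cases "C = A")
            case True
            then show ?thesis by (simp add: DCom covers.mem)
          next
            case False
            then have "settled (\<Gamma> + \<Lambda>) C" using settled that by simp
            then show ?thesis by (rule settled_covers) (auto simp: add intro: covers.mem)
          qed
          show "D x (\<Gamma>' + {#dia_all B#} + add_mset A \<Lambda> + {#Box i G#})" if "G \<in> \<F>" for G
            using prems[rule_format, OF that] by (rule D_weaken) (auto simp: add)
        qed
        then have "D (raise n x) (\<Gamma> + \<Lambda> + {#Box i F#} + {#dia_all B#})"
          by (rule D_weaken) (auto simp: add)
        then show ?thesis by (rule D_dcomI[OF _ step, rotated]) (simp add: add DCom)
      qed (use settle in simp_all)
    qed
  qed
qed

text \<open>The formulas \<open>\<Theta>\<close> required inside the box are supplied by diamonds
  outside it, which the box rule strips. Decomposition starts with nothing settled.\<close>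

lemma adm_box:
  fixes \<F> :: "('i::{finite,linorder}, 'p) fm set"
  assumes "adm \<Theta> ((\<lambda>G. {#G#}) ` \<F>) {#F#}"
  shows "adm (Dia i ` \<Theta>) ((\<lambda>G. {#Box i G#}) ` \<F>) {#Box i F#}"
  unfolding adm_def
proof
  fix w
  obtain n where n: "\<And>\<Gamma> \<Lambda> x. Dia i ` \<Theta> \<subseteq> set_mset (\<Gamma> + \<Lambda>) \<Longrightarrow> wts \<Gamma> \<le> w \<Longrightarrow>
    wts (unbox i \<Lambda>) \<le> 0 \<Longrightarrow> (\<And>A. A \<in># \<Lambda> \<Longrightarrow> settled (\<Gamma> + \<Lambda>) A) \<Longrightarrow>
    (\<And>G. G \<in> \<F> \<Longrightarrow> D x (\<Gamma> + \<Lambda> + {#Box i G#})) \<Longrightarrow> D (raise n x) (\<Gamma> + \<Lambda> + {#Box i F#})"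
    using adm_box_settling[OF assms, of i w 0] by meson
  have "unbox i {#} = ({#} :: ('i, 'p) fm multiset)" by (simp add: unbox_def)
  then have "D (raise n x) (\<Gamma> + {#Box i F#})"
    if "Dia i ` \<Theta> \<subseteq> set_mset \<Gamma>" "wts \<Gamma> \<le> w"
      "\<forall>N \<in> (\<lambda>G. {#Box i G#}) ` \<F>. D x (\<Gamma> + N)" for \<Gamma> x
    using n[of \<Gamma> "{#}" x] that by auto
  then show "\<exists>n. \<forall>\<Gamma> x. Dia i ` \<Theta> \<subseteq> set_mset \<Gamma> \<longrightarrow> wts \<Gamma> \<le> w \<longrightarrow>
     (\<forall>N \<in> (\<lambda>G. {#Box i G#}) ` \<F>. D x (\<Gamma> + N)) \<longrightarrow> D (raise n x) (\<Gamma> + {#Box i F#})"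
    by blast
qed

end

section \<open>From nested to shallow proofs\<close>

text \<open>The corresponding formula before its disjuncts are listed and folded, so that the top
  level of a sequent can be handled without an order.\<close>

definition disjuncts ::
  "'p \<Rightarrow> ('i, 'p) fm rel \<Rightarrow> ('i \<times> ('i, 'p) nseq) rel \<Rightarrow> ('i, 'p) nseq \<Rightarrow> ('i, 'p) fm multiset" where
  "disjuncts p rF rB \<Gamma> =
    image_mset (\<lambda>x. case x of Fm A \<Rightarrow> A | Bx i \<Delta> \<Rightarrow> Box i (corr_fm p rF rB \<Delta>)) \<Gamma>"

lemma disjuncts_simps [simp]:
  "disjuncts p rF rB {#} = {#}"
  "disjuncts p rF rB (add_mset (Fm A) \<Gamma>) = add_mset A (disjuncts p rF rB \<Gamma>)"
  "disjuncts p rF rB (add_mset (Bx i \<Delta>) \<Gamma>) =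
    add_mset (Box i (corr_fm p rF rB \<Delta>)) (disjuncts p rF rB \<Gamma>)"
  "disjuncts p rF rB (\<Gamma> + \<Delta>) = disjuncts p rF rB \<Gamma> + disjuncts p rF rB \<Delta>"
  by (simp_all add: disjuncts_def)

text \<open>Hides the two orders: later arguments only use that some list enumerates the
  disjuncts.\<close>

lemma corr_fm_eq_foldl1:
  assumes rF: "linear_order rF" and rB: "linear_order rB" and "\<Gamma> \<noteq> {#}"
  obtains xs where "xs \<noteq> []" "mset xs = disjuncts p rF rB \<Gamma>" "corr_fm p rF rB \<Gamma> = foldl1 Or xs"
proof -
  obtain as where as: "mset as = fms \<Gamma>" "sorted_wrt (\<lambda>x y. (x, y) \<in> rF) as"
    using ex1_sorted_list[OF rF] by metis
  obtain bs where bs: "mset bs = boxeds \<Gamma>" "sorted_wrt (\<lambda>x y. (x, y) \<in> rB) bs"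
    using ex1_sorted_list[OF rB] by metis
  define xs where "xs = as @ map (\<lambda>(i, \<Delta>). Box i (corr_fm p rF rB \<Delta>)) bs"
  have "mset xs = disjuncts p rF rB \<Gamma>"
    unfolding xs_def mset_append mset_map as(1) bs(1) fms_def boxeds_def
    by (induction \<Gamma>) (auto split: item.splits simp: disjuncts_def)
  moreover from this have "xs \<noteq> []" using assms(3) by (auto simp: disjuncts_def)
  moreover have "corr_fm p rF rB \<Gamma> = foldl1 Or xs"
    using assms(3)
    by (subst corr_fm.simps) (simp add: xs_def map_sorted_eqI[OF rF as] map_sorted_eqI[OF rB bs])
  ultimately show thesis using that by blast
qed

lemma corr_fm_single:
  assumes "linear_order rF" "linear_order rB"
  shows "corr_fm p rF rB {#Fm A#} = A"
proof -
  obtain xs where "mset xs = {#A#}" "corr_fm p rF rB {#Fm A#} = foldl1 Or xs"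
    using corr_fm_eq_foldl1[OF assms, of "{#Fm A#}" p] by auto
  then show ?thesis by simp
qed

context rank
begin

lemma D_foldl1_Or:
  assumes "xs \<noteq> []"
  shows "D x (\<Gamma> + mset xs) \<Longrightarrow> D (raise (length xs) x) (\<Gamma> + {#foldl1 Or xs#})"
  using assms
proof (induction xs arbitrary: \<Gamma> rule: rev_nonempty_induct)
  case (single A)
  then show ?case using D_raise_mono[of 0 x _ 1] by simp
next
  case (snoc A xs)
  have "D (raise (length xs) x) ((\<Gamma> + {#A#}) + {#foldl1 Or xs#})"
    using snoc.prems by (intro snoc.IH) (simp add: union_commute)
  then have "D (raise (length xs) x)
      (\<Gamma> + {#foldl1 Or (xs @ [A])#} + {#foldl1 Or xs, A#})"
    by (rule D_weaken) auto
  then have "D (raise (Suc (length xs)) x) (\<Gamma> + {#foldl1 Or (xs @ [A])#})"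
    by (rule D_disjI[OF _ raise_Suc_greater, rotated]) (simp add: foldl1_snoc snoc.hyps)
  then show ?case by simp
qed

text \<open>Unfolding the disjunctions of the premises is inversion and costs nothing; folding that
  of the conclusion costs at most \<open>size \<Delta>\<close>. Premises must be nonempty, because
  the formula of the empty sequent is not a disjunction of its members.\<close>

lemma adm_corr_fm:
  assumes rF: "linear_order rF" and rB: "linear_order rB" and "{#} \<notin> \<Q>"
    and adm: "adm \<Theta> (disjuncts p rF rB ` \<Q>) (disjuncts p rF rB \<Delta>)"
  shows "adm \<Theta> ((\<lambda>G. {#G#}) ` (corr_fm p rF rB ` \<Q>)) {#corr_fm p rF rB \<Delta>#}"
  unfolding adm_def
proof
  fix w
  obtain n where n: "\<And>\<Gamma> x. \<Theta> \<subseteq> set_mset \<Gamma> \<Longrightarrow> wts \<Gamma> \<le> w \<Longrightarrow>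
    (\<And>N. N \<in> disjuncts p rF rB ` \<Q> \<Longrightarrow> D x (\<Gamma> + N)) \<Longrightarrow>
    D (raise n x) (\<Gamma> + disjuncts p rF rB \<Delta>)"
    using adm by (rule admE[where w = w]) blast
  have main: "D (raise (n + size \<Delta>) x) (\<Gamma> + {#corr_fm p rF rB \<Delta>#})"
    if "\<Theta> \<subseteq> set_mset \<Gamma>" "wts \<Gamma> \<le> w"
      and prems: "\<forall>N \<in> (\<lambda>G. {#G#}) ` (corr_fm p rF rB ` \<Q>). D x (\<Gamma> + N)" for \<Gamma> x
  proof -
    have "D x (\<Gamma> + disjuncts p rF rB E)" if E: "E \<in> \<Q>" for E
    proof -
      obtain xs where xs: "xs \<noteq> []" "mset xs = disjuncts p rF rB E"
        "corr_fm p rF rB E = foldl1 Or xs"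
        using corr_fm_eq_foldl1[OF rF rB, of E p] E assms(3) by blast
      have "D x (\<Gamma> + {#foldl1 Or xs#})" using prems E xs(3) by auto
      then show ?thesis
        by (rule D_covers)
          (use xs in \<open>auto intro!: covers_foldl1_Or simp flip: xs(2) intro: covers.mem\<close>)
    qed
    then have concl: "D (raise n x) (\<Gamma> + disjuncts p rF rB \<Delta>)"
      using that(1,2) by (intro n) auto
    show ?thesis
    proof (cases "\<Delta> = {#}")
      \<comment> \<open>An empty \<open>\<Delta>\<close>, as may arise in the conclusion of the
        diamond rule, contributes only the formula \<open>\<bottom>\<close>, added by
        weakening.\<close>
      case True
      then show ?thesis using concl by (auto elim!: D_weaken)
    next
      case False
      then obtain xs where xs: "xs \<noteq> []" "mset xs = disjuncts p rF rB \<Delta>"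
        "corr_fm p rF rB \<Delta> = foldl1 Or xs"
        using corr_fm_eq_foldl1[OF rF rB, of \<Delta> p] by blast
      have "length xs = size \<Delta>"
        using arg_cong[OF xs(2), of size] by (simp add: disjuncts_def)
      then show ?thesis using D_foldl1_Or[OF xs(1), of "raise n x" \<Gamma>] concl xs by simp
    qed
  qed
  show "\<exists>n. \<forall>\<Gamma> x. \<Theta> \<subseteq> set_mset \<Gamma> \<longrightarrow> wts \<Gamma> \<le> w \<longrightarrow>
     (\<forall>N \<in> (\<lambda>G. {#G#}) ` (corr_fm p rF rB ` \<Q>). D x (\<Gamma> + N)) \<longrightarrow>
     D (raise n x) (\<Gamma> + {#corr_fm p rF rB \<Delta>#})"
    using main by blast
qed

text \<open>Each level of the context is crossed by folding the inner sequent, boxing its formula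
  and absorbing the formulas beside the box. Nonemptiness is carried along because the folding step
  requires it.\<close>

lemma adm_fill:
  assumes "linear_order rF" "linear_order rB" "{#} \<notin> \<Q>"
    and "adm {} (disjuncts p rF rB ` \<Q>) (disjuncts p rF rB \<Delta>)"
  shows "adm {} (disjuncts p rF rB ` fill G ` \<Q>) (disjuncts p rF rB (fill G \<Delta>)) \<and>
    {#} \<notin> fill G ` \<Q>"
proof (induction G)
  case (Hole \<Gamma>)
  then show ?case using adm_absorb[OF assms(4), of "disjuncts p rF rB \<Gamma>"] assms(3)
    by (auto simp: image_image)
next
  case (Inside \<Gamma> i G)
  then have "adm {} ((\<lambda>G. {#G#}) ` (corr_fm p rF rB ` fill G ` \<Q>))
      {#corr_fm p rF rB (fill G \<Delta>)#}"
    using adm_corr_fm[OF assms(1,2)] by blast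
  from adm_absorb[OF adm_box[OF this, of i], of "disjuncts p rF rB \<Gamma>"]
  show ?case by (simp add: image_image) auto
qed

text \<open>
  By induction on \<open>k\<close>, and on \<open>x\<close> inside: a box rule replaces \<open>Dia i ((dia_all ^^ k) A)\<close> by
  \<open>(dia_all ^^ k) A\<close>, which the induction hypothesis for \<open>k\<close> removes.
\<close>

lemma D_dcom_funpow:
  assumes "D x (\<Gamma> + {#(dia_all ^^ Suc k) A#})" "DCom A \<in># \<Gamma>"
  shows "D (raise 1 x) \<Gamma>"
  using assms
proof (induction k arbitrary: x \<Gamma>)
  case 0
  then show ?case using D_dcomI[OF _ raise_1_greater] by simp
next
  case (Suc k)
  define B where "B = (dia_all ^^ Suc k) A"
  \<comment> \<open>The outer disjunction is split beforehand. As \<open>?E\<close> consists of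
    diamonds, no rule has its principal formula there, and only box rules affect it.\<close>
  let ?E = "mset (map (\<lambda>i. Dia i B) agents)"
  have main: "D (raise 1 x) \<Gamma>" if "D x (\<Gamma> + ?E)" "DCom A \<in># \<Gamma>" for x \<Gamma>
    using that
  proof (induction x arbitrary: \<Gamma> rule: wf_induct_rule[OF wf_lex])
    case (1 x)
    have IH: "D (raise 1 y) (\<Gamma> + N)" if "(y, x) \<in> lex" "D y (\<Gamma> + ?E + N)" for y N
    proof (rule 1(1)[OF that(1)])
      show "D y (\<Gamma> + N + ?E)" using that(2) by (rule D_weaken) auto
    qed (use 1(3) in simp)
    from 1(2) show ?case
    proof (cases rule: D_cases)
      case (ax p)
      then show ?thesis by (intro D_axI) auto
    next
      case (conj C C' y z)
      then have "D (raise 1 y) (\<Gamma> + {#C#})" "D (raise 1 z) (\<Gamma> + {#C'#})"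
        using IH by blast+
      moreover have "And C C' \<in># \<Gamma>" using conj(1) by auto
      ultimately show ?thesis
        using raise_mono[OF conj(2)] raise_mono[OF conj(4)] D_conjI by blast
    next
      case (disj C C' y)
      then have "D (raise 1 y) (\<Gamma> + {#C, C'#})" "Or C C' \<in># \<Gamma>"
        using IH[OF disj(2,3)] by auto
      then show ?thesis using raise_mono[OF disj(2)] D_disjI by blast
    next
      case (com C)
      show ?thesis
      proof (rule D_comI)
        show "Com C \<in># \<Gamma>" using com(1) by auto
        show "\<exists>y. (y, raise 1 x) \<in> lex \<and> D y (\<Gamma> + {#(box_all ^^ (k + 1)) C#})" for k
          using com(2)[of k] IH raise_mono by blast
      qed
    next
      case (dcom C y)
      then have "D (raise 1 y) (\<Gamma> + {#dia_all C#})" "DCom C \<in># \<Gamma>"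
        using IH[OF dcom(2,3)] by auto
      then show ?thesis using raise_mono[OF dcom(2)] D_dcomI by blast
    next
      case (box i C y)
      have "D y (unbox i \<Gamma> + {#C#} + {#(dia_all ^^ Suc k) A#})"
        using box(3) by (rule D_weaken) (auto simp: set_unbox B_def)
      \<comment> \<open>The hypothesis for \<open>k\<close> is used here instead of the one for
        smaller \<open>x\<close>, so the increases do not add up.\<close>
      then have "D (raise 1 y) (unbox i \<Gamma> + {#C#})"
        by (rule Suc.IH) (use 1(3) in \<open>auto simp: set_unbox\<close>)
      moreover have "Box i C \<in># \<Gamma>" using box(1) by auto
      ultimately show ?thesis using raise_mono[OF box(2)] D_boxI by blast
    qed
  qed
  have "covers (\<Gamma> + ?E) (dia_all B)"
    unfolding dia_all_def by (rule covers_foldl1_Or) (auto simp: agents_nonempty intro: covers.mem)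
  then have "D x (\<Gamma> + ?E)"
    by (intro D_covers[OF Suc.prems(1)]) (auto simp: B_def intro: covers.mem)
  then show ?case using main Suc.prems(2) by blast
qed

text \<open>Every rule is checked at the hole only, and \<open>adm_fill\<close> lifts it to the
  whole context.\<close>

lemma adm_DC:
  fixes \<Gamma> :: "('i::{finite,linorder}, 'p) nseq"
  assumes rF: "linear_order rF" and rB: "linear_order rB" and "DC P \<Gamma>"
  shows "adm {} (disjuncts p rF rB ` ran P) (disjuncts p rF rB \<Gamma>) \<and> {#} \<notin> ran P"
  using assms(3)
proof cases
  note fill = adm_fill[OF rF rB]
  let ?d = "disjuncts p rF rB"
  {
    case (ax G q)
    have "adm {} (?d ` {}) (?d {#Fm (Pos q), Fm (Neg q)#})"
      by (rule admI[of _ _ 0]) (auto intro!: D_axI)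
    from fill[OF _ this, of G] show ?thesis by (simp add: ax)
  next
    case (conj G A B)
    have "adm {} (?d ` {{#Fm A#}, {#Fm B#}}) (?d {#Fm (And A B)#})"
    proof (rule admI[of _ _ 1])
      fix \<Gamma> :: "('i, 'p) fm multiset" and x
      assume prem: "\<And>N. N \<in> ?d ` {{#Fm A#}, {#Fm B#}} \<Longrightarrow> D x (\<Gamma> + N)"
      have "D x (\<Gamma> + ?d {#Fm (And A B)#} + {#A#})" "D x (\<Gamma> + ?d {#Fm (And A B)#} + {#B#})"
        by (auto intro: D_weaken[OF prem[of "{#A#}"]] D_weaken[OF prem[of "{#B#}"]])
      then show "D (raise 1 x) (\<Gamma> + ?d {#Fm (And A B)#})"
        by (rule D_conjI[OF _ raise_1_greater _ raise_1_greater, rotated]) simp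
    qed
    from fill[OF _ this, of G] show ?thesis by (simp add: conj insert_commute)
  next
    case (disj G A B)
    have "adm {} (?d ` {{#Fm A, Fm B#}}) (?d {#Fm (Or A B)#})"
    proof (rule admI[of _ _ 1])
      fix \<Gamma> :: "('i, 'p) fm multiset" and x
      assume prem: "\<And>N. N \<in> ?d ` {{#Fm A, Fm B#}} \<Longrightarrow> D x (\<Gamma> + N)"
      have "D x (\<Gamma> + ?d {#Fm (Or A B)#} + {#A, B#})"
        using prem[of "{#A, B#}"] by (auto elim!: D_weaken)
      then show "D (raise 1 x) (\<Gamma> + ?d {#Fm (Or A B)#})"
        by (rule D_disjI[OF _ raise_1_greater, rotated]) simp
    qed
    from fill[OF _ this, of G] show ?thesis by (simp add: disj)
  next
    case (box G i A)
    \<comment> \<open>The boxed sequent and \<open>Box i A\<close> have the same corresponding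
      formula, so this rule costs nothing.\<close>
    have "adm {} (?d ` {{#Bx i {#Fm A#}#}}) (?d {#Fm (Box i A)#})"
      by (rule admI[of _ _ 0]) (simp add: corr_fm_single[OF rF rB])
    from fill[OF _ this, of G] show ?thesis by (simp add: box)
  next
    case (dia G i A \<Delta>)
    have "adm {A} (?d ` {\<Delta> + {#Fm A#}}) (?d \<Delta>)"
    proof (rule admI[of _ _ 0])
      fix \<Gamma> :: "('i, 'p) fm multiset" and x
      assume A: "{A} \<subseteq> set_mset \<Gamma>"
        and prem: "\<And>N. N \<in> ?d ` {\<Delta> + {#Fm A#}} \<Longrightarrow> D x (\<Gamma> + N)"
      have "D x (\<Gamma> + ?d (\<Delta> + {#Fm A#}))" by (rule prem) simp
      then show "D (raise 0 x) (\<Gamma> + ?d \<Delta>)"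
        unfolding raise_0 by (rule D_weaken) (use A in auto)
    qed
    \<comment> \<open>Inside the box, dropping \<open>A\<close> is contraction with the copy
      required by \<open>\<Theta> = {A}\<close>. Boxing turns this requirement into
      \<open>Dia i A\<close>, which the rule keeps beside the box.\<close>
    from adm_absorb[OF adm_box[OF adm_corr_fm[OF rF rB _ this], of i], of "{#Dia i A#}"]
    have "adm {} (?d ` {{#Fm (Dia i A), Bx i (\<Delta> + {#Fm A#})#}}) (?d {#Fm (Dia i A), Bx i \<Delta>#})"
      by (simp add: add_mset_commute)
    from fill[OF _ this, of G] show ?thesis by (simp add: dia)
  next
    case (com G A)
    have adm: "adm {} (?d ` range (\<lambda>k. {#Fm ((box_all ^^ (k + 1)) A)#})) (?d {#Fm (Com A)#})"
    proof (rule admI[of _ _ 1])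
      fix \<Gamma> :: "('i, 'p) fm multiset" and x
      assume prem: "\<And>N. N \<in> ?d ` range (\<lambda>k. {#Fm ((box_all ^^ (k + 1)) A)#}) \<Longrightarrow> D x (\<Gamma> + N)"
      have "D x (\<Gamma> + {#Com A#} + {#(box_all ^^ (k + 1)) A#})" for k
      proof (rule D_weaken)
        have "{#(box_all ^^ (k + 1)) A#} = ?d {#Fm ((box_all ^^ (k + 1)) A)#}" by simp
        then show "D x (\<Gamma> + {#(box_all ^^ (k + 1)) A#})" by (intro prem) blast
      qed auto
      then have "\<exists>y. (y, raise 1 x) \<in> lex \<and> D y (\<Gamma> + {#Com A#} + {#(box_all ^^ (k + 1)) A#})" for k
        using raise_1_greater by blast
      then have "D (raise 1 x) (\<Gamma> + {#Com A#})" by (rule D_comI[rotated]) simp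
      then show "D (raise 1 x) (\<Gamma> + ?d {#Fm (Com A)#})" by simp
    qed
    have "ran P = fill G ` range (\<lambda>k. {#Fm ((box_all ^^ (k + 1)) A)#})"
      unfolding com(1) ran_def by blast
    moreover have "{#} \<notin> range (\<lambda>k. {#Fm ((box_all ^^ (k + 1)) A)#})" by auto
    ultimately show ?thesis using fill[OF _ adm, of G] com(2) by (simp only: simp_thms)
  next
    case (dcom k G A)
    have "adm {} (?d ` {{#Fm (DCom A), Fm ((dia_all ^^ k) A)#}}) (?d {#Fm (DCom A)#})"
    proof (rule admI[of _ _ 1])
      fix \<Gamma> :: "('i, 'p) fm multiset" and x
      assume prem: "\<And>N. N \<in> ?d ` {{#Fm (DCom A), Fm ((dia_all ^^ k) A)#}} \<Longrightarrow> D x (\<Gamma> + N)"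
      obtain j where j: "k = Suc j" using dcom(3) by (cases k) auto
      have "D x (\<Gamma> + {#DCom A#} + {#(dia_all ^^ Suc j) A#})"
        using prem[of "{#DCom A, (dia_all ^^ k) A#}"] unfolding j
        by (simp add: add_mset_commute del: funpow.simps)
      then show "D (raise 1 x) (\<Gamma> + ?d {#Fm (DCom A)#})"
        by (intro D_dcom_funpow[of x _ j A]) (simp_all del: funpow.simps)
    qed
    from fill[OF _ this, of G] show ?thesis by (simp add: dcom)
  }
qed

lemma ranked_DC_imp_D:
  assumes rF: "linear_order rF" and rB: "linear_order rB" and "ranked DC lt a \<Gamma>"
  shows "\<exists>n. D (n, a) {#corr_fm p rF rB \<Gamma>#}"
  using assms(3)
proof induction
  case (rankedI P \<Gamma> a)
  \<comment> \<open>The premises have ranks \<open>(n, b)\<close> with \<open>b\<close> below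
    \<open>a\<close>. Even if the numbers \<open>n\<close> are unbounded, all these ranks lie below
    \<open>(0, a)\<close>, the common rank that \<open>adm\<close> asks for.\<close>
  have prem: "D (0, a) {#corr_fm p rF rB \<Delta>#}" if \<Delta>: "\<Delta> \<in> ran P" for \<Delta>
  proof -
    obtain k where "P k = Some \<Delta>" using \<Delta> by (auto simp: ran_def)
    then obtain b n where "(b, a) \<in> lt" "D (n, b) {#corr_fm p rF rB \<Delta>#}"
      using rankedI.IH by blast
    then show ?thesis by (elim D_mono) (simp add: lex_def)
  qed
  have "adm {} ((\<lambda>G. {#G#}) ` (corr_fm p rF rB ` ran P)) {#corr_fm p rF rB \<Gamma>#}"
    using adm_DC[OF rF rB rankedI.hyps(1), of p] adm_corr_fm[OF rF rB] by blast
  then obtain n where n: "\<And>\<Lambda> x. {} \<subseteq> set_mset \<Lambda> \<Longrightarrow> wts \<Lambda> \<le> 0 \<Longrightarrow>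
    (\<And>N. N \<in> (\<lambda>G. {#G#}) ` (corr_fm p rF rB ` ran P) \<Longrightarrow> D x (\<Lambda> + N)) \<Longrightarrow>
    D (raise n x) (\<Lambda> + {#corr_fm p rF rB \<Gamma>#})"
    by (rule admE[where w = 0]) blast
  have "D (raise n (0, a)) ({#} + {#corr_fm p rF rB \<Gamma>#})"
    by (rule n) (use prem in auto)
  then show ?case by (auto simp: raise_def)
qed

end

section \<open>Return to ordinals, and the bound
  \<open>\<omega> \<cdot> (\<alpha> + 1)\<close>\<close>

text \<open>The lexicographic order agrees with the ordinal product over \<open>Field s\<close>, and
  ranks descending from a point there never leave it.\<close>

lemma ranked_lex_imp_ord_mult:
  assumes s: "Well_order s" and rank: "rank (s - Id)"
    and "ranked S (rank.lex (s - Id)) x \<Gamma>" "snd x \<in> Field s"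
  shows "ranked S (ord_mult natLeq s - Id) x \<Gamma>"
  using assms(3,4)
proof induction
  case (rankedI P \<Gamma> x)
  show ?case
  proof (rule ranked.rankedI[of S P])
    fix k \<Delta>
    assume "P k = Some \<Delta>"
    then obtain y where y: "(y, x) \<in> rank.lex (s - Id)"
      and IH: "snd y \<in> Field s \<Longrightarrow> ranked S (ord_mult natLeq s - Id) y \<Delta>"
      using rankedI.IH by blast
    have "snd y \<in> Field s"
      using y rankedI.prems by (auto simp: rank.lex_def[OF rank] intro: FieldI1)
    moreover have "(y, x) \<in> ord_mult natLeq s - Id"
      using y rankedI.prems calculation
      by (auto simp: rank.lex_def[OF rank] ord_mult_def natLeq_def
          Field_natLeq[unfolded natLeq_def])
    ultimately show "\<exists>y. (y, x) \<in> ord_mult natLeq s - Id \<and> ranked S (ord_mult natLeq s - Id) y \<Delta>"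
      using IH by blast
  qed (fact rankedI.hyps)
qed

lemma ordLess_ord_succ:
  assumes "Well_order r"
  shows "r <o ord_succ r"
proof -
  note succ = Well_order_ord_succ[OF assms]
  have "r =o dir_image r Some" using assms by (rule dir_image_ordIso) simp
  also have "dir_image r Some = Restr (ord_succ r) (underS (ord_succ r) None)"
    by (auto simp: dir_image_def ord_succ_def underS_def FieldI1 FieldI2)
  also have "\<dots> <o ord_succ r"
    using underS_Restr_ordLess[OF succ] by (auto simp: Field_ord_succ)
  finally show ?thesis .
qed

theorem theorem3p20:
  fixes p :: 'p
    and rF :: "('i::{finite,linorder}, 'p) fm rel"
    and rB :: "('i \<times> ('i, 'p) nseq) rel"
    and \<Gamma> :: "('i, 'p) nseq"
    and \<alpha> :: "'o rel"
  assumes "linear_order rF"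
    and "linear_order rB"
    and "Well_order \<alpha>"
    and "derivable DC \<alpha> \<Gamma>"
  shows "derivable GC (ord_mult natLeq (ord_succ \<alpha>)) {#corr_fm p rF rB \<Gamma>#}"
proof -
  let ?s = "ord_succ \<alpha>" and ?R = "ord_mult natLeq (ord_succ \<alpha>)"
  have s: "Well_order ?s" using assms(3) by (rule Well_order_ord_succ)
  have R: "Well_order ?R" using natLeq_Well_order s by (rule Well_order_ord_mult)
  have rank: "rank (?s - Id)"
  proof
    show "wf (?s - Id)" using s by (simp add: well_order_on_def)
    show "trans (?s - Id)"
      using s by (intro trans_diff_Id)
        (auto simp: well_order_on_def linear_order_on_def partial_order_on_def preorder_on_def)
  qed
  obtain t where t: "is_proof DC t" "concl t = \<Gamma>" "depth t \<le>o \<alpha>"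
    using assms(4) by (auto simp: derivable_def)
  \<comment> \<open>The successor makes the bound strict, so that the depth of \<open>t\<close> is
    represented by a point of \<open>?s\<close>.\<close>
  have "depth t <o ?s" using t(3) ordLess_ord_succ[OF assms(3)] by (rule ordLeq_ordLess_trans)
  then obtain a where a: "a \<in> Field ?s" "ranked DC (?s - Id) a \<Gamma>"
    using derivable_imp_ranked[OF s t(1)] t(2) by blast
  then obtain n where "ranked GC (rank.lex (?s - Id)) (n, a) {#corr_fm p rF rB \<Gamma>#}"
    using rank.ranked_DC_imp_D[OF rank assms(1,2)] by blast
  then have "ranked GC (?R - Id) (n, a) {#corr_fm p rF rB \<Gamma>#}"
    using a(1) by (intro ranked_lex_imp_ord_mult[OF s rank]) auto
  from ranked_imp_derivable[OF R this]
  obtain u where u: "is_proof GC u" "concl u = {#corr_fm p rF rB \<Gamma>#}"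
    "depth u \<le>o Restr ?R (underS ?R (n, a))"
    unfolding derivable_def by blast
  have "Field ?R \<noteq> {}"
    using a(1) by (auto simp: Field_ord_mult[OF natLeq_Well_order s] Field_natLeq)
  \<comment> \<open>The finite part \<open>n\<close> is unknown, but \<open>(n, a)\<close> is a
    point of the product, so its initial segment is at most the whole product.\<close>
  then have "Restr ?R (underS ?R (n, a)) \<le>o ?R"
    using underS_Restr_ordLess[OF R] ordLess_imp_ordLeq by blast
  then show ?thesis using u ordLeq_transitive unfolding derivable_def by blast
qed

end
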